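(* Let $H$ be a graph with at least one edge. Then: (i) if $H$ contains a pendant edge, then $\lim_{n\to \infty} \frac{\mathrm{rwsat}(n, H)}{n}=0$; (ii) if $H$ contains no pendant edge, then $\frac{1}{2}\delta'(H)\leq \lim_{n\to \infty} \frac{\mathrm{rwsat}(n, H)}{n}\leq \delta'(H)$.
   Context: All graphs are finite and simple. An edge is pendant if one of its endpoints has degree $1$. For a graph $H$, $\delta'(H)=\min\{d_H(v)\colon v\in V(H),\ d_H(v)\neq 0\}$. An edge-coloring of a graph $G$ is a map $c\colon E(G)\to\mathbb{N}$; a subgraph is rainbow if its edges receive pairwise distinct colors. For a fixed graph $H$, an edge-colored graph $G$ is called weakly $H$-rainbow saturated if there exists an ordering $e_1,\dots,e_m$ of the non-edges of $G$ such that for every list $c_1,\dots,c_m$ of pairwise distinct colors from $\mathbb{N}$ (which may coincide with colors already used on $G$), for every $i\in[m]$ the edge-colored graph obtained from $G$ by adding $e_1,\dots,e_i$ with $e_k$ colored $c_k$ contains a rainbow copy of $H$ containing the edge $e_i$. ($G$ itself need not be free of rainbow copies of $H$.) $\mathrm{rwsat}(n,H)$ is the minimum number of edges of a weakly $H$-rainbow saturated edge-colored graph on $n$ vertices (defined as $\binom n2$ if none exists). (The limit is known to exist.) *)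

theory Defs
  imports Complex_Main "HOL-Library.Ramsey"
begin

record 'a sgraph =
  verts :: "'a set"
  edges :: "'a set set"

text \<open>The library notation \<open>[V]\<^bsup>2\<^esup>\<close> denotes the set of all two-element subsets of \<open>V\<close>,
  so loops and multiple edges are excluded.\<close>

definition finite_simple_graph :: "'a sgraph \<Rightarrow> bool" where
  "finite_simple_graph G \<longleftrightarrow> finite (verts G) \<and> edges G \<subseteq> [verts G]\<^bsup>2\<^esup>"

definition degree :: "'a sgraph \<Rightarrow> 'a \<Rightarrow> nat" where
  "degree G v = card {e \<in> edges G. v \<in> e}"

definition pendant_edge :: "'a sgraph \<Rightarrow> 'a set \<Rightarrow> bool" where
  "pendant_edge G e \<longleftrightarrow> e \<in> edges G \<and> (\<exists>v\<in>e. degree G v = 1)"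

definition min_pos_degree :: "'a sgraph \<Rightarrow> nat" where
  "min_pos_degree H = Min {degree H v |v. v \<in> verts H \<and> degree H v \<noteq> 0}"

definition subgraph :: "'a sgraph \<Rightarrow> 'a sgraph \<Rightarrow> bool" where
  "subgraph F G \<longleftrightarrow> finite_simple_graph F \<and> verts F \<subseteq> verts G \<and> edges F \<subseteq> edges G"

definition isomorphic :: "'a sgraph \<Rightarrow> 'b sgraph \<Rightarrow> bool" where
  "isomorphic H F \<longleftrightarrow>
     (\<exists>f. bij_betw f (verts H) (verts F) \<and>
          (\<forall>u\<in>verts H. \<forall>v\<in>verts H. {u, v} \<in> edges H \<longleftrightarrow> {f u, f v} \<in> edges F))"

text \<open>An edge-coloring of \<open>G\<close> is represented by a total function on vertex sets; only its values on
  \<open>edges G\<close> are ever relevant.\<close>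

definition rainbow :: "('a set \<Rightarrow> nat) \<Rightarrow> 'a sgraph \<Rightarrow> bool" where
  "rainbow c F \<longleftrightarrow> inj_on c (edges F)"

definition add_edges :: "'a sgraph \<Rightarrow> 'a set list \<Rightarrow> 'a sgraph" where
  "add_edges G es = G\<lparr>edges := edges G \<union> set es\<rparr>"

definition extend_coloring ::
    "('a set \<Rightarrow> nat) \<Rightarrow> 'a set list \<Rightarrow> nat list \<Rightarrow> 'a set \<Rightarrow> nat" where
  "extend_coloring c es cs e =
     (case map_of (zip es cs) e of None \<Rightarrow> c e | Some k \<Rightarrow> k)"

definition has_rainbow_copy_containing ::
    "'b sgraph \<Rightarrow> 'a sgraph \<Rightarrow> ('a set \<Rightarrow> nat) \<Rightarrow> 'a set \<Rightarrow> bool" where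
  "has_rainbow_copy_containing H G c e \<longleftrightarrow>
     (\<exists>F. subgraph F G \<and> isomorphic H F \<and> rainbow c F \<and> e \<in> edges F)"

text \<open>Lists are indexed from 0, so \<open>take (Suc i) es\<close> consists of the first \<open>i + 1\<close> added edges, the
  last of which is \<open>es ! i\<close>.\<close>

definition weakly_rainbow_saturated ::
    "'b sgraph \<Rightarrow> 'a sgraph \<Rightarrow> ('a set \<Rightarrow> nat) \<Rightarrow> bool" where
  "weakly_rainbow_saturated H G c \<longleftrightarrow>
     (\<exists>es. distinct es \<and> set es = [verts G]\<^bsup>2\<^esup> - edges G \<and>
        (\<forall>cs. length cs = length es \<longrightarrow> distinct cs \<longrightarrow>
           (\<forall>i<length es.
              has_rainbow_copy_containing H
                (add_edges G (take (Suc i) es))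
                (extend_coloring c (take (Suc i) es) (take (Suc i) cs))
                (es ! i))))"

text \<open>The host graphs may be taken to have natural numbers as vertices, since every finite graph is
  isomorphic to such a graph.\<close>

definition saturated_sizes :: "nat \<Rightarrow> 'b sgraph \<Rightarrow> nat set" where
  "saturated_sizes n H =
     {card (edges G) |(G :: nat sgraph) c.
        finite_simple_graph G \<and> card (verts G) = n \<and> weakly_rainbow_saturated H G c}"

definition rwsat :: "nat \<Rightarrow> 'b sgraph \<Rightarrow> nat" where
  "rwsat n H =
     (if saturated_sizes n H = {} then n choose 2 else (LEAST m. m \<in> saturated_sizes n H))"

end

theory Submission
  imports Defs "HOL-Library.Nat_Bijection"
begin

text \<open>Rainbow copies through a new edge are found in two ways. If all their edges are added ones, they
  are rainbow for free, since added edges have distinct colors. If the new edge is the only added one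
  and the old edges involved are rainbow, at most one old edge clashes with it, and it can be avoided
  when there is one vertex to spare.

  For the upper bound, fix a constant-size skeleton: a rainbow clique \<open>Z\<close> joined to an independent set
  \<open>Y\<close>. A further vertex with \<open>\<delta>'\<close> old edges to \<open>Z\<close> (none if \<open>\<delta>' = 1\<close>) can be joined to all of
  \<open>Z \<union> Y\<close>, acting as a vertex of minimum degree of \<open>H\<close>. Once every vertex is joined to \<open>Y\<close> by added
  edges, all remaining edges can be added. This gives \<open>rwsat n H \<le> \<delta>' n + O(1)\<close>, and \<open>O(1)\<close> if
  \<open>\<delta>' = 1\<close>. For the existence of the limit, many copies of an optimal saturated graph on \<open>m\<close>
  vertices are glued to the skeleton: since it is sparse, \<open>o(m)\<close> old edges per copy suffice, namely
  from its vertices of high degree and from two constant-size independent sets to \<open>Z\<close>.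

  For the lower bound, if a vertex had degree \<open>\<delta>' - 1 \<ge> 1\<close> in a saturated graph, the first edge added
  at it could repeat the color of an old edge there, although the copy of \<open>H\<close> needs both.\<close>

section \<open>Order-independent saturation\<close>

text \<open>A copy is kept as an injection rather than as a subgraph, so that it can be composed
  with vertex maps. \<open>V\<close> appears besides \<open>E\<close> because isolated vertices of
  \<open>H\<close> must be placed too.\<close>

definition rainbow_embedding ::
    "'b sgraph \<Rightarrow> 'v set \<Rightarrow> 'v set set \<Rightarrow> ('v set \<Rightarrow> nat) \<Rightarrow> 'v set \<Rightarrow> ('b \<Rightarrow> 'v) \<Rightarrow> bool" where
  "rainbow_embedding H V E c e f \<longleftrightarrow>
     inj_on f (verts H) \<and> f ` verts H \<subseteq> V \<and> (`) f ` edges H \<subseteq> E \<and>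
     inj_on c ((`) f ` edges H) \<and> e \<in> (`) f ` edges H"

lemma rainbow_embedding_mono:
  "rainbow_embedding H V E c e f \<Longrightarrow> V \<subseteq> V' \<Longrightarrow> E \<subseteq> E' \<Longrightarrow> rainbow_embedding H V' E' c e f"
  unfolding rainbow_embedding_def by (meson subset_trans)

text \<open>An isomorphism carries the edge set of \<open>H\<close> exactly onto that of the copy,
  because all edges are two-element sets of vertices. Conversely, the image of \<open>H\<close>
  under an injection is itself the required subgraph.\<close>

lemma has_rainbow_copy_containing_iff:
  assumes "finite_simple_graph H"
  shows "has_rainbow_copy_containing H G c e \<longleftrightarrow>
         (\<exists>f. rainbow_embedding H (verts G) (edges G) c e f)"
proof
  assume "has_rainbow_copy_containing H G c e"
  then obtain F f where F: "finite_simple_graph F" "verts F \<subseteq> verts G" "edges F \<subseteq> edges G"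
      "rainbow c F" "e \<in> edges F"
    and f: "bij_betw f (verts H) (verts F)"
      "\<forall>u\<in>verts H. \<forall>v\<in>verts H. {u, v} \<in> edges H \<longleftrightarrow> {f u, f v} \<in> edges F"
    unfolding has_rainbow_copy_containing_def subgraph_def isomorphic_def by blast
  have "(`) f ` edges H = edges F"
  proof
    show "(`) f ` edges H \<subseteq> edges F"
      using assms f(2) unfolding finite_simple_graph_def by (auto elim!: nsets2_E dest!: subsetD)
    show "edges F \<subseteq> (`) f ` edges H"
    proof
      fix g assume g: "g \<in> edges F"
      then obtain x y where xy: "g = {x, y}" "x \<in> verts F" "y \<in> verts F"
        using F(1) unfolding finite_simple_graph_def by (meson nsets2_E subsetD)
      then obtain u v where "u \<in> verts H" "v \<in> verts H" "f u = x" "f v = y"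
        using bij_betw_imp_surj_on[OF f(1)] by (metis imageE)
      then have "{u, v} \<in> edges H" "g = f ` {u, v}"
        using f(2) xy g by auto
      then show "g \<in> (`) f ` edges H" by blast
    qed
  qed
  then show "\<exists>f. rainbow_embedding H (verts G) (edges G) c e f"
    using F f(1) unfolding rainbow_embedding_def rainbow_def bij_betw_def by metis
next
  assume "\<exists>f. rainbow_embedding H (verts G) (edges G) c e f"
  then obtain f where f: "inj_on f (verts H)" "f ` verts H \<subseteq> verts G" "(`) f ` edges H \<subseteq> edges G"
      "inj_on c ((`) f ` edges H)" "e \<in> (`) f ` edges H"
    unfolding rainbow_embedding_def by blast
  define F where "F = \<lparr>verts = f ` verts H, edges = (`) f ` edges H\<rparr>"
  have H: "finite (verts H)" "edges H \<subseteq> [verts H]\<^bsup>2\<^esup>"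
    using assms by (auto simp: finite_simple_graph_def)
  have "(`) f ` edges H \<subseteq> [f ` verts H]\<^bsup>2\<^esup>"
  proof
    fix g assume "g \<in> (`) f ` edges H"
    then obtain x y where "g = f ` {x, y}" "x \<noteq> y" "x \<in> verts H" "y \<in> verts H"
      using H(2) by (smt (verit) imageE nsets2_E subsetD)
    then show "g \<in> [f ` verts H]\<^bsup>2\<^esup>" using f(1) by (auto dest: inj_onD)
  qed
  then have "subgraph F G"
    using f H(1) by (auto simp: F_def subgraph_def finite_simple_graph_def)
  moreover have "isomorphic H F"
    unfolding isomorphic_def
  proof (intro exI conjI ballI)
    show "bij_betw f (verts H) (verts F)"
      using f(1) by (simp add: F_def bij_betw_def)
    fix u v assume uv: "u \<in> verts H" "v \<in> verts H"
    \<comment> \<open>By injectivity an edge is determined by its image, so no non-edge of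
      \<open>H\<close> is sent to an edge of \<open>F\<close>.\<close>
    have "g = {u, v}" if "g \<in> edges H" "f ` g = f ` {u, v}" for g
    proof -
      have "g \<subseteq> verts H" using that(1) H(2) by (auto simp: nsets_def)
      then show ?thesis using inj_on_image_eq_iff[OF f(1)] uv that(2) by (metis bot_least insert_subset)
    qed
    then show "{u, v} \<in> edges H \<longleftrightarrow> {f u, f v} \<in> edges F"
      by (auto simp: F_def image_iff)
  qed
  ultimately show "has_rainbow_copy_containing H G c e"
    using f by (auto simp: has_rainbow_copy_containing_def rainbow_def F_def)
qed

text \<open>Quantifying over all colorings, instead of lists of new colors, makes this monotone in \<open>S\<close>, so
  that edges can be added in any convenient order.\<close>

definition addable ::
    "'b sgraph \<Rightarrow> 'v set \<Rightarrow> 'v set set \<Rightarrow> ('v set \<Rightarrow> nat) \<Rightarrow> 'v set set \<Rightarrow> 'v set \<Rightarrow> bool" where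
  "addable H V E c S e \<longleftrightarrow>
     (\<forall>col. (\<forall>g\<in>E. col g = c g) \<longrightarrow> inj_on col (insert e S) \<longrightarrow>
            (\<exists>f. rainbow_embedding H V (insert e (E \<union> S)) col e f))"

text \<open>Only the set of added edges is recorded; an order in which they were added is hidden in
  the derivation.\<close>

inductive fillable ::
    "'b sgraph \<Rightarrow> 'v set \<Rightarrow> 'v set set \<Rightarrow> ('v set \<Rightarrow> nat) \<Rightarrow> 'v set set \<Rightarrow> bool"
    for H V E c where
  fillable_empty: "fillable H V E c {}"
| fillable_insert: "fillable H V E c S \<Longrightarrow> e \<in> [V]\<^bsup>2\<^esup> - E - S \<Longrightarrow> addable H V E c S e \<Longrightarrow>
    fillable H V E c (insert e S)"

lemma fillable_subset: "fillable H V E c S \<Longrightarrow> S \<subseteq> [V]\<^bsup>2\<^esup> - E"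
  by (induction rule: fillable.induct) auto

text \<open>A coloring admissible for the larger data is admissible for the smaller, since
  injectivity passes to subsets and the colors on \<open>E\<close> agree. The copy found there
  survives in the larger graph.\<close>

lemma addable_mono:
  assumes "addable H V E c S e" "V \<subseteq> V'" "E \<subseteq> E'" "\<And>g. g \<in> E \<Longrightarrow> c' g = c g" "S \<subseteq> S'"
  shows "addable H V' E' c' S' e"
  unfolding addable_def
proof (intro allI impI)
  fix col assume col: "\<forall>g\<in>E'. col g = c' g" "inj_on col (insert e S')"
  have "inj_on col (insert e S)"
    using assms(5) by (intro inj_on_subset[OF col(2)]) auto
  moreover have "\<forall>g\<in>E. col g = c g" using assms(3,4) col(1) by auto
  ultimately obtain f where "rainbow_embedding H V (insert e (E \<union> S)) col e f"
    using assms(1) unfolding addable_def by blast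
  then have "rainbow_embedding H V' (insert e (E' \<union> S')) col e f"
    by (rule rainbow_embedding_mono) (use assms(2,3,5) in auto)
  then show "\<exists>f. rainbow_embedding H V' (insert e (E' \<union> S')) col e f" by (rule exI[of _ f])
qed

text \<open>The derivation of \<open>S\<close> is replayed on top of \<open>S'\<close>, skipping
  edges that are already there. This is how a filling of a small graph is used inside a larger host;
  disjointness from \<open>E'\<close> keeps the replayed edges non-edges.\<close>

lemma fillable_lift:
  assumes "fillable H V E c S" "V \<subseteq> V'" "E \<subseteq> E'" "\<And>g. g \<in> E \<Longrightarrow> c' g = c g" "S \<inter> E' = {}"
    and "fillable H V' E' c' S'"
  shows "fillable H V' E' c' (S' \<union> S)"
  using assms(1,5)
proof (induction rule: fillable.induct)
  case fillable_empty
  then show ?case using assms(6) by simp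
next
  case (fillable_insert S e)
  then have IH: "fillable H V' E' c' (S' \<union> S)" by auto
  show ?case
  proof (cases "e \<in> S'")
    case True
    then show ?thesis using IH by (simp add: insert_absorb)
  next
    case False
    have "addable H V' E' c' (S' \<union> S) e"
      by (rule addable_mono[OF fillable_insert.hyps(3) assms(2,3,4)]) auto
    moreover have "e \<in> [V']\<^bsup>2\<^esup> - E' - (S' \<union> S)"
      using fillable_insert.hyps(2) fillable_insert.prems False nsets_mono[OF assms(2), of 2] by auto
    ultimately show ?thesis using IH fillable.fillable_insert by fastforce
  qed
qed

text \<open>Edges that are all addable over the same \<open>S\<close> can be added one after
  another, since by monotonicity none of them spoils the others.\<close>

lemma fillable_Un:
  assumes "finite T" "fillable H V E c S" "T \<subseteq> [V]\<^bsup>2\<^esup> - E" "\<And>e. e \<in> T \<Longrightarrow> addable H V E c S e"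
  shows "fillable H V E c (S \<union> T)"
  using assms
proof (induction T rule: finite_induct)
  case (insert e T)
  then have IH: "fillable H V E c (S \<union> T)" by auto
  show ?case
  proof (cases "e \<in> S \<union> T")
    case True
    then show ?thesis using IH by (simp add: insert_absorb)
  next
    case False
    have "addable H V E c (S \<union> T) e"
      by (rule addable_mono[OF insert.prems(3)]) auto
    then show ?thesis using IH insert.prems(2) False fillable_insert[OF IH] by auto
  qed
qed auto

lemma fillable_imp_list:
  assumes "fillable H V E c S"
  shows "\<exists>es. distinct es \<and> set es = S \<and>
              (\<forall>i<length es. addable H V E c (set (take i es)) (es ! i))"
  using assms
proof (induction rule: fillable.induct)
  case (fillable_insert S e)
  then obtain es where "distinct es" "set es = S"
      "\<forall>i<length es. addable H V E c (set (take i es)) (es ! i)" by blast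
  then show ?case
    using fillable_insert.hyps by (intro exI[of _ "es @ [e]"]) (auto simp: nth_append less_Suc_eq)
qed simp

section \<open>Lists of new colors versus colorings\<close>

lemma extend_coloring_same:
  assumes "e \<notin> set es" "length es = length cs"
  shows "extend_coloring c es cs e = c e"
proof -
  have "map_of (zip es cs) e = None" using assms by (simp add: map_of_zip_is_None)
  then show ?thesis by (simp add: extend_coloring_def)
qed

lemma extend_coloring_nth:
  assumes "distinct es" "length es = length cs" "i < length es"
  shows "extend_coloring c es cs (es ! i) = cs ! i"
  using assms by (simp add: extend_coloring_def map_of_zip_nth)

lemma inj_on_extend_coloring:
  assumes "distinct es" "distinct cs" "length es = length cs"
  shows "inj_on (extend_coloring c es cs) (set es)"
proof (rule inj_onI)
  fix x y assume "x \<in> set es" "y \<in> set es" "extend_coloring c es cs x = extend_coloring c es cs y"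
  then show "x = y"
    by (smt (verit) assms extend_coloring_nth in_set_conv_nth nth_eq_iff_index_eq)
qed

text \<open>A list of distinct colors induces a coloring that is injective on the added edges.
  Conversely, such a coloring is the list of its values, up to colors that do not concern the stage
  in question.\<close>

lemma weakly_rainbow_saturated_iff_fillable:
  assumes "finite_simple_graph H"
  shows "weakly_rainbow_saturated H G c \<longleftrightarrow>
         fillable H (verts G) (edges G) c ([verts G]\<^bsup>2\<^esup> - edges G)"
proof
  assume "fillable H (verts G) (edges G) c ([verts G]\<^bsup>2\<^esup> - edges G)"
  then obtain es where es: "distinct es" "set es = [verts G]\<^bsup>2\<^esup> - edges G"
      "\<And>i. i < length es \<Longrightarrow> addable H (verts G) (edges G) c (set (take i es)) (es ! i)"
    using fillable_imp_list by blast
  show "weakly_rainbow_saturated H G c"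
    unfolding weakly_rainbow_saturated_def
  proof (intro exI[of _ es] conjI allI impI)
    fix cs :: "nat list" and i
    assume cs: "length cs = length es" "distinct cs" and i: "i < length es"
    let ?es = "take (Suc i) es" and ?cs = "take (Suc i) cs"
    have "inj_on (extend_coloring c ?es ?cs) (set ?es)"
      using es(1) cs by (intro inj_on_extend_coloring) auto
    moreover have "set ?es = insert (es ! i) (set (take i es))"
      using i by (auto simp: take_Suc_conv_app_nth)
    moreover have "extend_coloring c ?es ?cs g = c g" if "g \<in> edges G" for g
      using that es(2) cs set_take_subset[of "Suc i" es] by (intro extend_coloring_same) auto
    ultimately obtain f where "rainbow_embedding H (verts G)
        (insert (es ! i) (edges G \<union> set (take i es))) (extend_coloring c ?es ?cs) (es ! i) f"
      using es(3)[OF i] unfolding addable_def by metis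
    moreover have "insert (es ! i) (edges G \<union> set (take i es)) = edges (add_edges G ?es)"
      using \<open>set ?es = _\<close> by (simp add: add_edges_def)
    ultimately show "has_rainbow_copy_containing H (add_edges G ?es)
        (extend_coloring c ?es ?cs) (es ! i)"
      unfolding has_rainbow_copy_containing_iff[OF assms] by (auto simp: add_edges_def)
  qed (use es in auto)
next
  assume "weakly_rainbow_saturated H G c"
  then obtain es where es: "distinct es" "set es = [verts G]\<^bsup>2\<^esup> - edges G"
    and copy: "\<And>cs i. length cs = length es \<Longrightarrow> distinct cs \<Longrightarrow> i < length es \<Longrightarrow>
       has_rainbow_copy_containing H (add_edges G (take (Suc i) es))
         (extend_coloring c (take (Suc i) es) (take (Suc i) cs)) (es ! i)"
    unfolding weakly_rainbow_saturated_def by blast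
  have add: "addable H (verts G) (edges G) c (set (take i es)) (es ! i)" if i: "i < length es" for i
    unfolding addable_def
  proof (intro allI impI)
    fix col :: "_ \<Rightarrow> nat"
    assume col: "\<forall>g\<in>edges G. col g = c g" "inj_on col (insert (es ! i) (set (take i es)))"
    let ?es = "take (Suc i) es"
    have set_es: "set ?es = insert (es ! i) (set (take i es))"
      using i by (auto simp: take_Suc_conv_app_nth)
    \<comment> \<open>The coloring prescribes only the first \<open>i + 1\<close> entries of the
      list. The rest is filled with consecutive colors above all of these, which keeps the list
      distinct and does not affect stage \<open>i\<close>.\<close>
    define b where "b = Suc (Max (col ` set ?es))"
    define cs where "cs = map col ?es @ [b..<b + (length es - Suc i)]"
    have "col g < b" if "g \<in> set ?es" for g
      using that unfolding b_def less_Suc_eq_le by (intro Max_ge) auto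
    then have "distinct cs"
      using es(1) col(2) unfolding cs_def set_es[symmetric] by (fastforce simp: distinct_map)
    moreover have "length cs = length es" using i by (simp add: cs_def)
    ultimately obtain f where f: "rainbow_embedding H (verts G) (edges G \<union> set ?es)
        (extend_coloring c ?es (take (Suc i) cs)) (es ! i) f"
      using copy[of cs i] i unfolding has_rainbow_copy_containing_iff[OF assms]
      by (auto simp: add_edges_def)
    have take_cs: "take (Suc i) cs = map col ?es" using i by (simp add: cs_def)
    have "extend_coloring c ?es (take (Suc i) cs) g = col g" if "g \<in> edges G \<union> set ?es" for g
    proof (cases "g \<in> set ?es")
      case True
      then obtain j where "j < length ?es" "g = ?es ! j" by (metis in_set_conv_nth)
      then show ?thesis
        unfolding take_cs using es(1) by (subst \<open>g = _\<close>, subst extend_coloring_nth) auto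
    next
      case False
      then show ?thesis
        using that col(1) unfolding take_cs by (subst extend_coloring_same) auto
    qed
    then have "inj_on col ((`) f ` edges H)"
      using f unfolding rainbow_embedding_def by (smt (verit) inj_on_cong subsetD)
    then show "\<exists>f. rainbow_embedding H (verts G)
        (insert (es ! i) (edges G \<union> set (take i es))) col (es ! i) f"
      using f set_es by (intro exI[of _ f]) (auto simp: rainbow_embedding_def)
  qed
  have "fillable H (verts G) (edges G) c (set (take i es))" if "i \<le> length es" for i
    using that
  proof (induction i)
    case (Suc i)
    then have i: "i < length es" by simp
    have "es ! i \<notin> set (take i es)"
      using es(1) i by (metis distinct_take not_distinct_conv_prefix take_Suc_conv_app_nth)
    then have "es ! i \<in> [verts G]\<^bsup>2\<^esup> - edges G - set (take i es)"
      using es(2) nth_mem[OF i] by blast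
    then show ?case
      using Suc i add[OF i] fillable_insert by (force simp: take_Suc_conv_app_nth)
  qed (simp add: fillable_empty)
  from this[of "length es"] show "fillable H (verts G) (edges G) c ([verts G]\<^bsup>2\<^esup> - edges G)"
    using es(2) by simp
qed

text \<open>Serves the lower bound: at this moment a copy can use, at \<open>v\<close>, only old
  edges and the single new edge \<open>e\<close>.\<close>

lemma fillable_first_edge_at:
  assumes "fillable H V E c S" "\<exists>e\<in>S. v \<in> e"
  shows "\<exists>T e. addable H V E c T e \<and> T \<subseteq> S \<and> e \<in> S - T \<and> v \<in> e \<and> (\<forall>g\<in>T. v \<notin> g)"
  using assms
proof (induction rule: fillable.induct)
  case (fillable_insert S e)
  show ?case
  proof (cases "\<exists>g\<in>S. v \<in> g")
    case True
    then obtain T g where "addable H V E c T g" "T \<subseteq> S" "g \<in> S - T" "v \<in> g" "\<forall>g\<in>T. v \<notin> g"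
      using fillable_insert.IH by blast
    then show ?thesis by (intro exI[of _ T] exI[of _ g]) auto
  next
    case False
    then have "v \<in> e" using fillable_insert.prems by auto
    then show ?thesis
      using False fillable_insert.hyps by (intro exI[of _ S] exI[of _ e]) auto
  qed
qed simp

text \<open>A coloring of the image is pulled back along \<open>\<phi>\<close>, and the copy
  obtained for it is pushed forward again.\<close>

lemma fillable_image:
  assumes "fillable H V E c S" "inj_on \<phi> V" "E \<subseteq> Pow V" "\<And>g. g \<in> E \<Longrightarrow> c' (\<phi> ` g) = c g"
    and H: "edges H \<subseteq> Pow (verts H)"
  shows "fillable H (\<phi> ` V) ((`) \<phi> ` E) c' ((`) \<phi> ` S)"
  using assms(1)
proof (induction rule: fillable.induct)
  case (fillable_insert S e)
  have S: "S \<subseteq> Pow V" using fillable_subset[OF fillable_insert.hyps(1)] by (auto simp: nsets_def)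
  have e: "e \<subseteq> V" using fillable_insert.hyps(2) by (auto simp: nsets_def)
  have inj: "inj_on ((`) \<phi>) (Pow V)" using assms(2) by (rule inj_on_image_Pow)
  have "\<phi> ` e \<in> [\<phi> ` V]\<^bsup>2\<^esup>"
    using fillable_insert.hyps(2) assms(2) by (auto elim!: nsets2_E dest: inj_onD)
  moreover have "\<phi> ` e \<notin> (`) \<phi> ` E" "\<phi> ` e \<notin> (`) \<phi> ` S"
    using fillable_insert.hyps(2) e S assms(3) inj by (auto dest!: inj_onD[OF inj])
  moreover have "addable H (\<phi> ` V) ((`) \<phi> ` E) c' ((`) \<phi> ` S) (\<phi> ` e)"
    unfolding addable_def
  proof (intro allI impI)
    fix col assume col: "\<forall>g\<in>(`) \<phi> ` E. col g = c' g" "inj_on col (insert (\<phi> ` e) ((`) \<phi> ` S))"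
    have "inj_on (col \<circ> (`) \<phi>) (insert e S)"
      using col(2) inj_on_subset[OF inj, of "insert e S"] e S by (intro comp_inj_on) auto
    moreover have "\<forall>g\<in>E. (col \<circ> (`) \<phi>) g = c g" using col(1) assms(4) by auto
    ultimately obtain f where f: "rainbow_embedding H V (insert e (E \<union> S)) (col \<circ> (`) \<phi>) e f"
      using fillable_insert.hyps(3) unfolding addable_def by blast
    have eq: "(`) (\<phi> \<circ> f) ` edges H = (`) \<phi> ` (`) f ` edges H"
      by (simp add: image_comp)
    have "inj_on col ((`) (\<phi> \<circ> f) ` edges H)"
      unfolding eq using f unfolding rainbow_embedding_def by (blast intro: inj_on_imageI)
    moreover have "inj_on (\<phi> \<circ> f) (verts H)"
      using f inj_on_subset[OF assms(2)] unfolding rainbow_embedding_def by (intro comp_inj_on) simp_all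
    moreover have "(\<phi> \<circ> f) ` verts H \<subseteq> \<phi> ` V"
      using f unfolding rainbow_embedding_def image_comp[symmetric] by (intro image_mono) simp
    moreover have "(`) \<phi> ` (`) f ` edges H \<subseteq> (`) \<phi> ` insert e (E \<union> S)"
      using f unfolding rainbow_embedding_def by (intro image_mono) simp
    moreover have "\<phi> ` e \<in> (`) \<phi> ` (`) f ` edges H"
      using f unfolding rainbow_embedding_def by (intro imageI) simp
    ultimately have "rainbow_embedding H (\<phi> ` V) (insert (\<phi> ` e) ((`) \<phi> ` E \<union> (`) \<phi> ` S)) col (\<phi> ` e)
        (\<phi> \<circ> f)"
      unfolding rainbow_embedding_def eq image_insert image_Un by blast
    then show "\<exists>f. rainbow_embedding H (\<phi> ` V)
        (insert (\<phi> ` e) ((`) \<phi> ` E \<union> (`) \<phi> ` S)) col (\<phi> ` e) f"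
      by (rule exI[of _ "\<phi> \<circ> f"])
  qed
  ultimately show ?case
    using fillable.fillable_insert[OF fillable_insert.IH, of "\<phi> ` e"] by simp
qed (simp add: fillable_empty)

section \<open>Sparse graphs and a convergence criterion\<close>

lemma sum_card_incident:
  assumes "finite U" "F \<subseteq> [U]\<^bsup>2\<^esup>"
  shows "(\<Sum>x\<in>U. card {e \<in> F. x \<in> e}) = 2 * card F"
proof -
  have "finite F" using assms finite_imp_finite_nsets finite_subset by blast
  have "card {x \<in> U. x \<in> e} = 2" if "e \<in> F" for e
  proof -
    have "e \<subseteq> U" "card e = 2" using that assms(2) by (auto simp: nsets_def)
    then have "{x \<in> U. x \<in> e} = e" by auto
    then show ?thesis using \<open>card e = 2\<close> by simp
  qed
  then have "(\<Sum>x\<in>U. card {e \<in> F. x \<in> e}) = (\<Sum>e\<in>F. 2)"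
    by (intro sum_multicount_gen) (use assms(1) \<open>finite F\<close> in auto)
  then show ?thesis by simp
qed

lemma card_neighbours_le:
  assumes "finite F"
  shows "card {w \<in> B. {x, w} \<in> F} \<le> card {e \<in> F. x \<in> e}"
  using assms by (intro card_inj_on_le[of "\<lambda>w. {x, w}"]) (auto simp: inj_on_def doubleton_eq_iff)

text \<open>Few vertices have degree at least \<open>D\<close>; let \<open>K\<close> consist of
  these. Ramsey's theorem outside \<open>K\<close> gives a clique on \<open>D + 1\<close> vertices,
  which the degrees forbid, or an independent set, which is split into two halves. A vertex outside
  \<open>K\<close> has fewer than \<open>D\<close> neighbours and thus many non-neighbours in each
  half.\<close>

lemma sparse_graph_independent_sets:
  fixes C \<epsilon> :: real and h :: nat
  assumes "0 < \<epsilon>" "\<epsilon> \<le> 1" "0 \<le> C"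
  obtains M where "\<And>U F. finite U \<Longrightarrow> F \<subseteq> [U]\<^bsup>2\<^esup> \<Longrightarrow> M \<le> card U \<Longrightarrow> card F \<le> C * card U \<Longrightarrow>
    \<exists>X\<^sub>1 X\<^sub>2 B\<^sub>1 B\<^sub>2. X\<^sub>1 \<subseteq> U \<and> X\<^sub>2 \<subseteq> U \<and> X\<^sub>1 \<inter> X\<^sub>2 = {} \<and> B\<^sub>1 \<subseteq> X\<^sub>1 \<and> B\<^sub>2 \<subseteq> X\<^sub>2 \<and>
      [B\<^sub>1]\<^bsup>2\<^esup> \<inter> F = {} \<and> [B\<^sub>2]\<^bsup>2\<^esup> \<inter> F = {} \<and>
      (\<forall>x\<in>U - (X\<^sub>1 \<union> X\<^sub>2). h \<le> card {w \<in> B\<^sub>1. {x, w} \<notin> F} \<and> h \<le> card {w \<in> B\<^sub>2. {x, w} \<notin> F}) \<and>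
      real (card X\<^sub>1 + card X\<^sub>2) \<le> \<epsilon> * card U"
proof -
  \<comment> \<open>Chosen such that \<open>4 * C \<le> D * \<epsilon>\<close>, which bounds
    \<open>card K\<close> by half of \<open>\<epsilon> * card U\<close>; the summand 1 keeps
    \<open>D\<close> positive.\<close>
  define D where "D = nat \<lceil>4 * C / \<epsilon>\<rceil> + 1"
  have "4 * C / \<epsilon> \<le> D" unfolding D_def by linarith
  then have D: "4 * C \<le> D * \<epsilon>" "0 < D" using assms by (auto simp: D_def field_simps)
  define t where "t = h + D"
  obtain r where r: "\<And>V E. finite V \<Longrightarrow> r \<le> card V \<Longrightarrow>
      \<exists>R\<subseteq>V. card R = D + 1 \<and> clique R E \<or> card R = 2 * t \<and> indep R (E :: 'a set set)"
    using ramsey2[of "D + 1" "2 * t"] by metis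
  \<comment> \<open>The first bound leaves \<open>r\<close> vertices outside \<open>K\<close>, which
    takes up at most half of \<open>U\<close>. The second makes the \<open>2 * t\<close> vertices of
    the independent set fit into the other half of \<open>\<epsilon> * card U\<close>.\<close>
  define M where "M = max (2 * r) (nat \<lceil>4 * t / \<epsilon>\<rceil>)"
  have "\<exists>X\<^sub>1 X\<^sub>2 B\<^sub>1 B\<^sub>2. X\<^sub>1 \<subseteq> U \<and> X\<^sub>2 \<subseteq> U \<and> X\<^sub>1 \<inter> X\<^sub>2 = {} \<and> B\<^sub>1 \<subseteq> X\<^sub>1 \<and> B\<^sub>2 \<subseteq> X\<^sub>2 \<and>
      [B\<^sub>1]\<^bsup>2\<^esup> \<inter> F = {} \<and> [B\<^sub>2]\<^bsup>2\<^esup> \<inter> F = {} \<and>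
      (\<forall>x\<in>U - (X\<^sub>1 \<union> X\<^sub>2). h \<le> card {w \<in> B\<^sub>1. {x, w} \<notin> F} \<and> h \<le> card {w \<in> B\<^sub>2. {x, w} \<notin> F}) \<and>
      real (card X\<^sub>1 + card X\<^sub>2) \<le> \<epsilon> * card U"
    if U: "finite U" "F \<subseteq> [U]\<^bsup>2\<^esup>" "M \<le> card U" "card F \<le> C * card U" for U :: "'a set" and F
  proof -
    have "finite F" using U(1,2) finite_imp_finite_nsets finite_subset by blast
    define deg where "deg x = card {e \<in> F. x \<in> e}" for x
    define K where "K = {x \<in> U. D \<le> deg x}"
    have "D * card K = (\<Sum>x\<in>K. D)" by simp
    also have "\<dots> \<le> (\<Sum>x\<in>K. deg x)" by (intro sum_mono) (simp add: K_def)
    also have "\<dots> \<le> (\<Sum>x\<in>U. deg x)" using U(1) by (intro sum_mono2) (auto simp: K_def)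
    also have "\<dots> = 2 * card F" unfolding deg_def using U(1,2) by (rule sum_card_incident)
    finally have "real (D * card K) \<le> 2 * (C * card U)" using U(4) by linarith
    also have "\<dots> \<le> D * (\<epsilon> * card U / 2)"
      using mult_right_mono[OF D(1), of "card U"] by (simp add: algebra_simps)
    finally have K: "card K \<le> \<epsilon> * card U / 2" using D(2) by simp
    have "card (U - K) = card U - card K"
      using U(1) by (intro card_Diff_subset) (auto simp: K_def intro: finite_subset)
    moreover have "\<epsilon> * card U \<le> card U" using mult_right_mono[OF assms(2), of "card U"] by simp
    then have "2 * card K \<le> card U" using K by linarith
    ultimately have "r \<le> card (U - K)" using U(3) unfolding M_def by linarith
    then obtain R where R: "R \<subseteq> U - K" "card R = D + 1 \<and> clique R F \<or> card R = 2 * t \<and> indep R F"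
      using r[of "U - K" F] U(1) by auto
    have finR: "finite R" using R(1) U(1) by (meson finite_Diff finite_subset)
    have deg_R: "deg x < D" if "x \<in> U - K" for x using that by (auto simp: K_def)
    have "\<not> clique R F" if card_R: "card R = D + 1"
    proof
      assume "clique R F"
      obtain x where x: "x \<in> R" using card_R by fastforce
      then have "R - {x} \<subseteq> {w \<in> R. {x, w} \<in> F}" using \<open>clique R F\<close> by (auto simp: clique_def)
      then have "card (R - {x}) \<le> card {w \<in> R. {x, w} \<in> F}" using finR by (intro card_mono) auto
      also have "\<dots> \<le> deg x" unfolding deg_def using \<open>finite F\<close> by (rule card_neighbours_le)
      finally show False using deg_R[of x] x R(1) card_R finR by auto
    qed
    then have R': "card R = 2 * t" "indep R F" using R(2) by auto
    then obtain B\<^sub>1 where B1: "B\<^sub>1 \<subseteq> R" "card B\<^sub>1 = t"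
      using obtain_subset_with_card_n[of t R] by auto
    define B\<^sub>2 where "B\<^sub>2 = R - B\<^sub>1"
    have B2: "B\<^sub>2 \<subseteq> R" "card B\<^sub>2 = t"
      using B1 R' finR by (auto simp: B\<^sub>2_def card_Diff_subset finite_subset)
    have "[R]\<^bsup>2\<^esup> \<inter> F = {}" using R'(2) by (auto simp: indep_def nsets_2_eq)
    then have "[B\<^sub>1]\<^bsup>2\<^esup> \<inter> F = {}" "[B\<^sub>2]\<^bsup>2\<^esup> \<inter> F = {}"
      using nsets_mono[OF B1(1), of 2] nsets_mono[OF B2(1), of 2] by blast+
    moreover have many: "h \<le> card {w \<in> B. {x, w} \<notin> F}" if "x \<in> U - K" "B \<subseteq> R" "card B = t" for x B
    proof -
      have "card {w \<in> B. {x, w} \<in> F} < D"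
        using card_neighbours_le[OF \<open>finite F\<close>, of B x] deg_R[OF that(1)] by (simp add: deg_def)
      moreover have "finite B" using that(2) finR finite_subset by blast
      then have "card B = card {w \<in> B. {x, w} \<in> F} + card {w \<in> B. {x, w} \<notin> F}"
        by (subst card_Un_disjoint[symmetric]) (auto intro: arg_cong[where f = card])
      ultimately show ?thesis using that(3) by (simp add: t_def)
    qed
    moreover have "real (card (K \<union> B\<^sub>1) + card B\<^sub>2) \<le> \<epsilon> * card U"
    proof -
      have "4 * t / \<epsilon> \<le> card U" using U(3) unfolding M_def by linarith
      then have "4 * t \<le> \<epsilon> * card U" using assms(1) by (simp add: field_simps)
      moreover have "card (K \<union> B\<^sub>1) \<le> card K + t" using card_Un_le[of K B\<^sub>1] B1(2) by simp
      ultimately show ?thesis using K B2(2) by linarith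
    qed
    moreover have "K \<union> B\<^sub>1 \<subseteq> U" "B\<^sub>2 \<subseteq> U" "(K \<union> B\<^sub>1) \<inter> B\<^sub>2 = {}"
      using R(1) B1(1) B2(1) by (auto simp: K_def B\<^sub>2_def)
    ultimately show ?thesis
      using many B1 B2 by (intro exI[of _ "K \<union> B\<^sub>1"] exI[of _ B\<^sub>2] exI[of _ B\<^sub>1]) auto
  qed
  then show ?thesis by (rule that)
qed

text \<open>The infimum of the eventual upper bounds is the limit superior. By the second hypothesis
  \<open>a m + \<epsilon>\<close> is such a bound for every late \<open>m\<close>, so no late term
  lies far below that infimum. This replaces a subadditivity argument.\<close>

lemma convergent_if_eventually_le_add:
  fixes a :: "nat \<Rightarrow> real"
  assumes "\<And>n. 0 \<le> a n"
    and "\<And>\<epsilon>. 0 < \<epsilon> \<Longrightarrow> \<exists>M. \<forall>m\<ge>M. \<forall>\<^sub>F n in sequentially. a n \<le> a m + \<epsilon>"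
  shows "convergent a"
proof -
  define A where "A = {x. \<forall>\<^sub>F n in sequentially. a n \<le> x}"
  have "A \<noteq> {}" using assms(2)[of 1] by (auto simp: A_def)
  have "0 \<le> x" if x: "x \<in> A" for x
  proof -
    obtain n where "a n \<le> x" using x by (auto simp: A_def eventually_sequentially)
    then show ?thesis using assms(1)[of n] by linarith
  qed
  then have bdd: "bdd_below A" by (rule bdd_belowI)
  have "a \<longlonglongrightarrow> Inf A"
  proof (rule LIMSEQ_I)
    fix \<epsilon> :: real assume "0 < \<epsilon>"
    then obtain x where x: "x \<in> A" "x < Inf A + \<epsilon>"
      using cInf_lessD[OF \<open>A \<noteq> {}\<close>, of "Inf A + \<epsilon>"] by auto
    obtain M where "\<forall>m\<ge>M. \<forall>\<^sub>F n in sequentially. a n \<le> a m + \<epsilon> / 2"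
      using assms(2)[of "\<epsilon> / 2"] \<open>0 < \<epsilon>\<close> by auto
    then have M: "Inf A \<le> a m + \<epsilon> / 2" if "M \<le> m" for m
      using cInf_lower[OF _ bdd, of "a m + \<epsilon> / 2"] that by (auto simp: A_def)
    obtain N where N: "\<And>n. N \<le> n \<Longrightarrow> a n \<le> x" using x(1) by (auto simp: A_def eventually_sequentially)
    have "norm (a n - Inf A) < \<epsilon>" if "max M N \<le> n" for n
      using M[of n] N[of n] x(2) that \<open>0 < \<epsilon>\<close> by (auto simp: abs_less_iff)
    then show "\<exists>no. \<forall>n\<ge>no. norm (a n - Inf A) < \<epsilon>" by blast
  qed
  then show ?thesis by (rule convergentI)
qed

section \<open>Rainbow copies through a new edge\<close>

text \<open>The edges besides \<open>{p, q}\<close> that a copy of \<open>H\<close> may use if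
  \<open>p\<close> plays a vertex of minimum positive degree, \<open>q\<close> one of its
  neighbours, \<open>W\<close> hosts its other neighbours, and \<open>A\<close> hosts everything
  except \<open>p\<close> and \<open>q\<close>.\<close>

definition join_edges :: "'v \<Rightarrow> 'v \<Rightarrow> 'v set \<Rightarrow> 'v set \<Rightarrow> 'v set set" where
  "join_edges p q W A = {{p, w} |w. w \<in> W} \<union> {{q, a} |a. a \<in> A} \<union> [A]\<^bsup>2\<^esup>"

locale nonempty_graph =
  fixes H :: "'b sgraph"
  assumes fsg: "finite_simple_graph H" and edges_nonempty: "edges H \<noteq> {}"
begin

lemma finite_verts: "finite (verts H)" and edges_subset: "edges H \<subseteq> [verts H]\<^bsup>2\<^esup>"
  using fsg by (auto simp: finite_simple_graph_def)

lemma finite_edges: "finite (edges H)"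
  using edges_subset finite_verts finite_imp_finite_nsets finite_subset by blast

lemma degree_pos:
  assumes "e \<in> edges H" "v \<in> e"
  shows "degree H v \<noteq> 0"
  using assms finite_edges by (auto simp: degree_def)

lemma min_pos_degree_le: "degree H v \<noteq> 0 \<Longrightarrow> v \<in> verts H \<Longrightarrow> min_pos_degree H \<le> degree H v"
  unfolding min_pos_degree_def using finite_verts by (intro Min_le) auto

lemma min_pos_degree_attained:
  obtains u where "u \<in> verts H" "degree H u = min_pos_degree H" "degree H u \<noteq> 0"
proof -
  obtain e where "e \<in> edges H" using edges_nonempty by auto
  then obtain v where "v \<in> verts H" "degree H v \<noteq> 0"
    using edges_subset degree_pos by (metis insertI1 nsets2_E subsetD)
  then have "{degree H v |v. v \<in> verts H \<and> degree H v \<noteq> 0} \<noteq> {}" by auto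
  moreover have "finite {degree H v |v. v \<in> verts H \<and> degree H v \<noteq> 0}"
    using finite_verts by auto
  ultimately have "min_pos_degree H \<in> {degree H v |v. v \<in> verts H \<and> degree H v \<noteq> 0}"
    unfolding min_pos_degree_def using Min_in by blast
  then show ?thesis using that by auto
qed

lemma degree_eq_card_neighbours: "degree H v = card {x. {v, x} \<in> edges H}"
proof -
  have "e \<in> (\<lambda>x. {v, x}) ` {x. {v, x} \<in> edges H}" if e: "e \<in> edges H" "v \<in> e" for e
  proof -
    obtain x y where "e = {x, y}" using e(1) edges_subset by (meson nsets2_E subsetD)
    then have "e = {v, x} \<or> e = {v, y}" using e(2) by auto
    then show ?thesis using e(1) by auto
  qed
  then have "{e \<in> edges H. v \<in> e} = (\<lambda>x. {v, x}) ` {x. {v, x} \<in> edges H}" by auto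
  moreover have "inj_on (\<lambda>x. {v, x}) {x. {v, x} \<in> edges H}"
    by (auto simp: inj_on_def doubleton_eq_iff)
  ultimately show ?thesis by (simp add: degree_def card_image)
qed

lemma min_degree_vertex:
  obtains u b where "{u, b} \<in> edges H" "card {x. {u, x} \<in> edges H} = min_pos_degree H"
    "min_pos_degree H < card (verts H)" "u \<in> verts H" "b \<in> verts H" "u \<noteq> b"
    "{x. {u, x} \<in> edges H} \<subseteq> verts H - {u}"
proof -
  obtain u where u: "u \<in> verts H" "degree H u = min_pos_degree H" "degree H u \<noteq> 0"
    by (rule min_pos_degree_attained)
  let ?N = "{x. {u, x} \<in> edges H}"
  have N: "?N \<subseteq> verts H - {u}" using edges_subset by (fastforce simp: nsets_def)
  have "card ?N \<noteq> 0" using u degree_eq_card_neighbours by simp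
  then obtain b where b: "b \<in> ?N" by (metis card.empty equals0I)
  have "card ?N \<le> card (verts H - {u})" using N finite_verts by (intro card_mono) auto
  also have "\<dots> < card (verts H)" using u(1) finite_verts by (intro psubset_card_mono) auto
  finally show ?thesis
    using that[of u b] N b u degree_eq_card_neighbours[of u] by auto
qed

lemma min_pos_degree_less: "min_pos_degree H < card (verts H)"
  using min_degree_vertex by metis

text \<open>A vertex \<open>u\<close> of minimum positive degree goes to \<open>p\<close> and a
  neighbour \<open>b\<close> of it to \<open>q\<close>. The other neighbours of \<open>u\<close> fit
  into \<open>W\<close>, and the remaining vertices into what is left of \<open>A\<close>. Edges
  avoiding \<open>u\<close> then lie inside \<open>A\<close> or join it to \<open>q\<close>.\<close>

lemma embedding_exists:
  assumes "finite A" "W \<subseteq> A" "p \<notin> A" "q \<notin> A" "p \<noteq> q"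
    and "min_pos_degree H - 1 \<le> card W" "card (verts H) - 2 \<le> card A"
  obtains f where "inj_on f (verts H)" "f ` verts H \<subseteq> insert p (insert q A)"
    "{p, q} \<in> (`) f ` edges H" "(`) f ` edges H \<subseteq> insert {p, q} (join_edges p q W A)"
proof -
  obtain u b where ub: "{u, b} \<in> edges H" "card {x. {u, x} \<in> edges H} = min_pos_degree H"
    "u \<in> verts H" "b \<in> verts H" "u \<noteq> b" "{x. {u, x} \<in> edges H} \<subseteq> verts H - {u}"
    using min_degree_vertex by metis
  define N where "N = {x. {u, x} \<in> edges H} - {b}"
  have N: "N \<subseteq> verts H - {u, b}" using ub(6) by (auto simp: N_def)
  have fin: "finite N" "finite W" using N finite_verts assms(1,2) by (auto intro: finite_subset)
  have "card N = min_pos_degree H - 1"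
    unfolding N_def using ub(1,2) fin(1) N_def by (subst card_Diff_singleton) auto
  then obtain f1 where f1: "inj_on f1 N" "f1 ` N \<subseteq> W"
    using card_le_inj[OF fin] assms(6) by metis
  define R where "R = verts H - {u, b} - N"
  have "card (verts H - {u, b}) = card (verts H) - 2"
    using ub finite_verts by (subst card_Diff_subset) auto
  then have "card R = card (verts H) - 2 - card N"
    unfolding R_def using N fin(1) by (subst card_Diff_subset) auto
  moreover have "card (A - f1 ` N) = card A - card N"
    using f1 assms(1,2) fin(1) by (subst card_Diff_subset) (auto simp: card_image)
  ultimately have "card R \<le> card (A - f1 ` N)" using assms(7) by simp
  then obtain f2 where f2: "inj_on f2 R" "f2 ` R \<subseteq> A - f1 ` N"
    using card_le_inj[of R "A - f1 ` N"] assms(1) finite_verts R_def by auto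
  define f where "f x = (if x = u then p else if x = b then q else if x \<in> N then f1 x else f2 x)" for x
  have fR: "f x = f2 x" if "x \<in> R" for x using that by (auto simp: f_def R_def)
  have fN: "f x = f1 x" if "x \<in> N" for x using that N by (auto simp: f_def)
  have fub: "f u = p" "f b = q" using ub by (auto simp: f_def)
  have V: "verts H = insert u (insert b (N \<union> R))" using N ub by (auto simp: R_def)
  have "inj_on f N" "inj_on f R"
    using f1(1) f2(1) fN fR inj_on_cong[of N f f1] inj_on_cong[of R f f2] by auto
  moreover have "f ` N = f1 ` N" "f ` R = f2 ` R" using fN fR by auto
  ultimately have "inj_on f (N \<union> R)"
    unfolding inj_on_Un using f2(2) by blast
  moreover have fA: "f x \<in> A" if "x \<in> N \<union> R" for x
  proof -
    have "f1 ` N \<subseteq> A" using f1(2) assms(2) by blast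
    then show ?thesis using that f2(2) fR fN by auto
  qed
  ultimately have "inj_on f (verts H)"
    unfolding V using fub assms(3-5) by (auto simp: inj_on_insert)
  moreover have "f ` verts H \<subseteq> insert p (insert q A)"
    unfolding V using fub fA by auto
  moreover have "{p, q} \<in> (`) f ` edges H"
    using ub(1) fub by (intro image_eqI[of _ _ "{u, b}"]) auto
  moreover have "(`) f ` edges H \<subseteq> insert {p, q} (join_edges p q W A)"
  proof
    fix g assume "g \<in> (`) f ` edges H"
    then obtain x y where xy: "g = {f x, f y}" "{x, y} \<in> edges H" "x \<in> verts H" "y \<in> verts H" "x \<noteq> y"
      using edges_subset by (smt (verit) image_empty image_iff image_insert nsets2_E subsetD)
    have u_case: "g \<in> insert {p, q} (join_edges p q W A)"
      if "g = {f u, f y}" "{u, y} \<in> edges H" for y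
    proof (cases "y = b")
      case False
      then have "y \<in> N" using that(2) by (simp add: N_def)
      then have "f y \<in> W" using f1(2) fN by (metis image_subset_iff)
      then show ?thesis using that(1) fub unfolding join_edges_def by blast
    qed (use that fub in simp)
    have b_case: "g \<in> join_edges p q W A" if "g = {f b, f y}" "y \<in> N \<union> R" for y
      using that(1) fub fA[OF that(2)] by (auto simp: join_edges_def)
    have "f x \<noteq> f y" using \<open>inj_on f (verts H)\<close> xy by (metis inj_onD)
    then have A_case: "g \<in> join_edges p q W A" if "x \<in> N \<union> R" "y \<in> N \<union> R"
      using fA[OF that(1)] fA[OF that(2)] xy(1) by (simp add: join_edges_def)
    consider "x = u" | "y = u" | "x = b" "y \<in> N \<union> R" | "y = b" "x \<in> N \<union> R" | "x \<in> N \<union> R" "y \<in> N \<union> R"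
      using xy(3-5) unfolding V by blast
    then show "g \<in> insert {p, q} (join_edges p q W A)"
    proof cases
      case 1
      then show ?thesis using u_case[of y] xy(1,2) by simp
    next
      case 2
      then show ?thesis using u_case[of x] xy(1,2) by (simp add: insert_commute)
    next
      case 3
      then show ?thesis using b_case[of y] xy(1) by simp
    next
      case 4
      then show ?thesis using b_case[of x] xy(1) by (simp add: insert_commute)
    next
      case 5
      then show ?thesis using A_case by simp
    qed
  qed
  ultimately show ?thesis using that by blast
qed

lemma rainbow_embedding_exists:
  assumes "finite A" "W \<subseteq> A" "p \<notin> A" "q \<notin> A" "p \<noteq> q"
    and "min_pos_degree H - 1 \<le> card W" "card (verts H) - 2 \<le> card A"
    and "insert p (insert q A) \<subseteq> V" "insert {p, q} (join_edges p q W A) \<subseteq> E"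
    and "inj_on col (insert {p, q} (join_edges p q W A))"
  shows "\<exists>f. rainbow_embedding H V E col {p, q} f"
proof -
  obtain f where f: "inj_on f (verts H)" "f ` verts H \<subseteq> insert p (insert q A)"
    "{p, q} \<in> (`) f ` edges H" "(`) f ` edges H \<subseteq> insert {p, q} (join_edges p q W A)"
    by (rule embedding_exists[OF assms(1-7)])
  then have "rainbow_embedding H V E col {p, q} f"
    unfolding rainbow_embedding_def
    using subset_trans[OF f(2) assms(8)] subset_trans[OF f(4) assms(9)] inj_on_subset[OF assms(10) f(4)]
    by simp
  then show ?thesis by (rule exI[of _ f])
qed

text \<open>With \<open>W = A = Q\<close> the copy consists of added edges only, and these have
  distinct colors.\<close>

lemma addable_by_added_edges:
  assumes "finite Q" "p \<in> V - Q" "q \<in> V - Q" "p \<noteq> q" "Q \<subseteq> V" "card (verts H) - 2 \<le> card Q"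
    and "\<And>x. x \<in> Q \<Longrightarrow> {p, x} \<in> S" "\<And>x. x \<in> Q \<Longrightarrow> {q, x} \<in> S" "[Q]\<^bsup>2\<^esup> \<subseteq> S"
  shows "addable H V E c S {p, q}"
  unfolding addable_def
proof (intro allI impI)
  fix col :: "_ \<Rightarrow> nat" assume inj: "inj_on col (insert {p, q} S)"
  have J: "join_edges p q Q Q \<subseteq> S" using assms(7-9) by (auto simp: join_edges_def)
  show "\<exists>f. rainbow_embedding H V (insert {p, q} (E \<union> S)) col {p, q} f"
  proof (rule rainbow_embedding_exists[of Q Q])
    show "min_pos_degree H - 1 \<le> card Q" using min_pos_degree_less assms(6) by simp
    show "inj_on col (insert {p, q} (join_edges p q Q Q))"
      using J by (intro inj_on_subset[OF inj]) auto
  qed (use assms J in auto)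
qed

text \<open>At most one old edge shares its color with the new edge, and dropping one of its endpoints
  from \<open>A\<close> avoids it. The hypothesis on \<open>card W\<close> holds for empty \<open>W\<close> if the minimum positive
  degree is 1.\<close>

lemma addable_by_old_edges:
  assumes "finite A" "W \<subseteq> A" "p \<in> V - A" "q \<in> V - A" "p \<noteq> q" "A \<subseteq> V"
    and "min_pos_degree H - 1 \<le> card W - 1" "card (verts H) \<le> card A"
    and J: "join_edges p q W A \<subseteq> E" and inj: "inj_on c (join_edges p q W A)"
  shows "addable H V E c S {p, q}"
  unfolding addable_def
proof (intro allI impI)
  fix col :: "_ \<Rightarrow> nat" assume col: "\<forall>g\<in>E. col g = c g"
  have "0 < card (verts H)" using min_pos_degree_less by simp
  then have "A \<noteq> {}" using assms(8) by auto
  have "\<exists>a\<in>A. \<forall>g\<in>join_edges p q W A. a \<notin> g \<longrightarrow> col g \<noteq> col {p, q}"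
  proof (cases "\<exists>g\<in>join_edges p q W A. col g = col {p, q}")
    case True
    then obtain g where g: "g \<in> join_edges p q W A" "col g = col {p, q}" by blast
    then obtain a where "a \<in> A" "a \<in> g"
      using assms(2) by (auto simp: join_edges_def nsets_2_eq)
    moreover have "g' = g" if "g' \<in> join_edges p q W A" "col g' = col {p, q}" for g'
      using that g J col inj by (metis inj_onD subsetD)
    ultimately show ?thesis by blast
  next
    case False
    then show ?thesis using \<open>A \<noteq> {}\<close> by blast
  qed
  then obtain a where a: "a \<in> A" "\<And>g. g \<in> join_edges p q W A \<Longrightarrow> a \<notin> g \<Longrightarrow> col g \<noteq> col {p, q}"
    by blast
  let ?J = "join_edges p q (W - {a}) (A - {a})"
  have sub: "?J \<subseteq> join_edges p q W A"
    unfolding join_edges_def using nsets_mono[of "A - {a}" A 2] by blast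
  have avoid: "a \<notin> g" if "g \<in> ?J" for g
    using that a(1) assms(3,4) by (auto simp: join_edges_def nsets_def)
  have "inj_on col ?J"
    using inj_on_subset[OF inj sub] sub J col inj_on_cong[of ?J col c] by blast
  moreover have "col {p, q} \<notin> col ` ?J"
  proof
    assume "col {p, q} \<in> col ` ?J"
    then obtain g where "g \<in> ?J" "col g = col {p, q}" by (metis imageE)
    then show False using a(2)[of g] sub avoid[of g] by blast
  qed
  ultimately have inj': "inj_on col (insert {p, q} ?J)" by (auto simp: inj_on_insert)
  show "\<exists>f. rainbow_embedding H V (insert {p, q} (E \<union> S)) col {p, q} f"
  proof (rule rainbow_embedding_exists[OF _ _ _ _ _ _ _ _ _ inj'])
    show "min_pos_degree H - 1 \<le> card (W - {a})"
      using assms(7) finite_subset[OF assms(2,1)] by (cases "a \<in> W") auto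
    show "card (verts H) - 2 \<le> card (A - {a})" using assms(1,8) a(1) by auto
    show "insert {p, q} ?J \<subseteq> insert {p, q} (E \<union> S)" using sub J by blast
  qed (use assms in auto)
qed

end

section \<open>Graphs over the skeleton\<close>

lemma card_join_le:
  assumes "finite X" "finite Z"
  shows "card {{x, z} |x z. x \<in> X \<and> z \<in> Z} \<le> card X * card Z"
proof -
  have "{{x, z} |x z. x \<in> X \<and> z \<in> Z} = (\<lambda>(x, z). {x, z}) ` (X \<times> Z)" by auto
  then show ?thesis using assms card_image_le[of "X \<times> Z"] by (simp add: card_cartesian_product)
qed

text \<open>The clique comes in two halves for the sake of blocks: a set attached to
  \<open>Z\<^sub>1\<close> by old edges cannot provide a copy of added edges through a vertex of
  \<open>Z\<^sub>1\<close>, but a second set, attached to \<open>Z\<^sub>2\<close>, can.\<close>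

locale skeleton = nonempty_graph H for H :: "'b sgraph" +
  fixes Z\<^sub>1 Z\<^sub>2 Y :: "nat set"
  assumes finite_skeleton: "finite Z\<^sub>1" "finite Z\<^sub>2" "finite Y"
    and disjoint_skeleton: "Z\<^sub>1 \<inter> Z\<^sub>2 = {}" "Z\<^sub>1 \<inter> Y = {}" "Z\<^sub>2 \<inter> Y = {}"
    and card_skeleton: "card (verts H) \<le> card Z\<^sub>1" "card (verts H) \<le> card Z\<^sub>2" "card (verts H) \<le> card Y"
begin

abbreviation Z :: "nat set" where "Z \<equiv> Z\<^sub>1 \<union> Z\<^sub>2"

text \<open>The colors on edges that meet \<open>Z\<close> are prescribed by an injection, so that graphs over the
  skeleton can be merged without renaming colors.\<close>

definition encoded :: "nat set set \<Rightarrow> (nat set \<Rightarrow> nat) \<Rightarrow> bool" where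
  "encoded E c \<longleftrightarrow> (\<forall>e\<in>E. e \<inter> Z \<noteq> {} \<longrightarrow> c e = set_encode e)"

text \<open>The invariant of the construction. Of the added edges it demands only those from outside
  vertices to the skeleton, since the other non-edges then follow; this makes it easy to preserve
  when pieces are attached. \<open>Y\<close> contains no old edges so that a copy on it can consist
  of added edges alone.\<close>

definition over_skeleton :: "nat set \<Rightarrow> nat set set \<Rightarrow> (nat set \<Rightarrow> nat) \<Rightarrow> bool" where
  "over_skeleton V E c \<longleftrightarrow>
     finite V \<and> Z \<union> Y \<subseteq> V \<and> E \<subseteq> [V]\<^bsup>2\<^esup> \<and> [Z]\<^bsup>2\<^esup> \<subseteq> E \<and> (\<forall>z\<in>Z. \<forall>y\<in>Y. {y, z} \<in> E) \<and>
     [Y]\<^bsup>2\<^esup> \<inter> E = {} \<and> encoded E c \<and>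
     (\<exists>S. fillable H V E c S \<and>
          (\<forall>v\<in>V - (Z \<union> Y). (\<forall>y\<in>Y. {v, y} \<in> S) \<and> (\<forall>z\<in>Z. {v, z} \<in> E \<union> S)))"

text \<open>Every edge of the join meets \<open>A\<close> and hence \<open>Z\<close>, so its color
  is its code; codes of finite sets are distinct, and the join is rainbow.\<close>

lemma addable_via_Z:
  assumes "E \<subseteq> [V]\<^bsup>2\<^esup>" "encoded E c" "A \<subseteq> Z" "W \<subseteq> A" "p \<in> V - A" "q \<in> V - A" "p \<noteq> q" "A \<subseteq> V"
    and "min_pos_degree H - 1 \<le> card W - 1" "card (verts H) \<le> card A"
    and "\<And>w. w \<in> W \<Longrightarrow> {p, w} \<in> E" "\<And>a. a \<in> A \<Longrightarrow> {q, a} \<in> E" "[A]\<^bsup>2\<^esup> \<subseteq> E"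
  shows "addable H V E c S {p, q}"
proof (rule addable_by_old_edges[of A W])
  show fin: "finite A" using assms(3) finite_skeleton by (meson finite_UnI finite_subset)
  show J: "join_edges p q W A \<subseteq> E" using assms(11-13) by (auto simp: join_edges_def)
  have "g \<inter> Z \<noteq> {}" if "g \<in> join_edges p q W A" for g
    using that assms(3,4) by (auto simp: join_edges_def nsets_2_eq)
  then have c: "c g = set_encode g" if "g \<in> join_edges p q W A" for g
    using that J assms(2) by (auto simp: encoded_def)
  have "finite g" if "g \<in> join_edges p q W A" for g
    using that J assms(1) by (auto simp: nsets_def dest!: subsetD)
  then have "inj_on set_encode (join_edges p q W A)"
    by (intro inj_on_subset[OF inj_on_set_encode]) auto
  then show "inj_on c (join_edges p q W A)" using c inj_on_cong by metis
qed (use assms in auto)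

text \<open>First the edges inside \<open>Y\<close> are added, using the old clique
  \<open>Z\<^sub>1\<close>. Every edge still missing has both ends outside the skeleton, and these
  are joined to \<open>Y\<close> by added edges.\<close>

lemma weakly_rainbow_saturated_over_skeleton:
  assumes "over_skeleton V E c"
  shows "weakly_rainbow_saturated H \<lparr>verts = V, edges = E\<rparr> c"
proof -
  obtain S where V: "finite V" "Z \<union> Y \<subseteq> V" "E \<subseteq> [V]\<^bsup>2\<^esup>" "[Z]\<^bsup>2\<^esup> \<subseteq> E"
      "\<And>z y. z \<in> Z \<Longrightarrow> y \<in> Y \<Longrightarrow> {y, z} \<in> E" "[Y]\<^bsup>2\<^esup> \<inter> E = {}" "encoded E c"
    and S: "fillable H V E c S"
      "\<And>v y. v \<in> V - (Z \<union> Y) \<Longrightarrow> y \<in> Y \<Longrightarrow> {v, y} \<in> S"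
      "\<And>v z. v \<in> V - (Z \<union> Y) \<Longrightarrow> z \<in> Z \<Longrightarrow> {v, z} \<in> E \<union> S"
    using assms unfolding over_skeleton_def by blast
  have fin: "finite ([V]\<^bsup>2\<^esup>)" using V(1) finite_imp_finite_nsets by blast
  have S1: "fillable H V E c (S \<union> [Y]\<^bsup>2\<^esup>)"
  proof (rule fillable_Un[OF _ S(1)])
    show "finite ([Y]\<^bsup>2\<^esup>)" using finite_skeleton(3) by (rule finite_imp_finite_nsets)
    show "[Y]\<^bsup>2\<^esup> \<subseteq> [V]\<^bsup>2\<^esup> - E" using V(2,6) nsets_mono[of Y V 2] by blast
    fix e assume "e \<in> [Y]\<^bsup>2\<^esup>"
    then obtain p q where pq: "e = {p, q}" "p \<in> Y" "q \<in> Y" "p \<noteq> q" by (meson nsets2_E)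
    show "addable H V E c S e"
      unfolding pq(1)
    proof (rule addable_via_Z[of _ _ _ Z\<^sub>1 Z\<^sub>1])
      show "min_pos_degree H - 1 \<le> card Z\<^sub>1 - 1"
        using min_pos_degree_less card_skeleton(1) by linarith
      show "[Z\<^sub>1]\<^bsup>2\<^esup> \<subseteq> E" using V(4) nsets_mono[of Z\<^sub>1 Z 2] by blast
    qed (use V pq disjoint_skeleton card_skeleton in auto)
  qed
  have "fillable H V E c (S \<union> [Y]\<^bsup>2\<^esup> \<union> ([V]\<^bsup>2\<^esup> - E - (S \<union> [Y]\<^bsup>2\<^esup>)))"
  proof (rule fillable_Un[OF _ S1])
    fix e assume e: "e \<in> [V]\<^bsup>2\<^esup> - E - (S \<union> [Y]\<^bsup>2\<^esup>)"
    then obtain p q where pq: "e = {p, q}" "p \<in> V" "q \<in> V" "p \<noteq> q" by (meson DiffD1 nsets2_E)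
    \<comment> \<open>An end in the skeleton would make the edge an old one or one of those already
      added, whatever part contains the other end.\<close>
    have "p' \<in> V - (Z \<union> Y)" if pq': "e = {p', q'}" "p' \<in> V" "q' \<in> V" "p' \<noteq> q'" for p' q'
    proof -
      consider "q' \<in> Z" | "q' \<in> Y" | "q' \<in> V - (Z \<union> Y)" using pq' by blast
      moreover have "{p', q'} \<notin> E" "{p', q'} \<notin> S" "{p', q'} \<notin> [Y]\<^bsup>2\<^esup>" "{p', q'} \<notin> [Z]\<^bsup>2\<^esup>"
        using e pq' V(4) by blast+
      ultimately show ?thesis
        using pq'(2,4) V(5)[of p' q'] V(5)[of q' p'] S(2)[of q' p'] S(3)[of q' p']
        by cases (auto simp: insert_commute)
    qed
    from this[of p q] this[of q p] have "p \<in> V - (Z \<union> Y)" "q \<in> V - (Z \<union> Y)"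
      using pq by (auto simp: insert_commute)
    then show "addable H V E c (S \<union> [Y]\<^bsup>2\<^esup>) e"
      unfolding pq(1) using V(2) S(2) pq(4) card_skeleton finite_skeleton
      by (intro addable_by_added_edges[of Y]) auto
  qed (use fin in auto)
  moreover have "S \<union> [Y]\<^bsup>2\<^esup> \<union> ([V]\<^bsup>2\<^esup> - E - (S \<union> [Y]\<^bsup>2\<^esup>)) = [V]\<^bsup>2\<^esup> - E"
    using fillable_subset[OF S1] by blast
  ultimately show ?thesis by (simp add: weakly_rainbow_saturated_iff_fillable[OF fsg])
qed

lemma rwsat_le_over_skeleton:
  assumes "over_skeleton V E c"
  shows "rwsat (card V) H \<le> card E"
proof -
  have "finite_simple_graph \<lparr>verts = V, edges = E\<rparr>"
    using assms by (simp add: over_skeleton_def finite_simple_graph_def)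
  then have "card E \<in> saturated_sizes (card V) H"
    unfolding saturated_sizes_def mem_Collect_eq using weakly_rainbow_saturated_over_skeleton[OF assms]
    by (intro exI[of _ "\<lparr>verts = V, edges = E\<rparr>"] exI[of _ c]) simp
  then show ?thesis unfolding rwsat_def by (auto intro: Least_le)
qed

lemma over_skeleton_base:
  obtains E c where "over_skeleton (Z \<union> Y) E c"
proof
  let ?E = "[Z]\<^bsup>2\<^esup> \<union> {{y, z} |y z. y \<in> Y \<and> z \<in> Z}"
  have "?E \<subseteq> [Z \<union> Y]\<^bsup>2\<^esup>"
    using disjoint_skeleton nsets_mono[of Z "Z \<union> Y" 2] by auto
  moreover have "[Y]\<^bsup>2\<^esup> \<inter> ?E = {}" using disjoint_skeleton by (auto simp: nsets_2_eq doubleton_eq_iff)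
  ultimately show "over_skeleton (Z \<union> Y) ?E set_encode"
    unfolding over_skeleton_def encoded_def using finite_skeleton
    by (auto intro!: exI[of _ "{}"] fillable_empty)
qed

text \<open>The new vertex plays a vertex of minimum degree, with its old neighbours in
  \<open>W\<close>; the skeleton vertex to be joined to it has old edges to all of \<open>Z\<close>
  but itself. If the minimum positive degree is 1, \<open>W\<close> may be empty.\<close>

lemma over_skeleton_add_vertex:
  assumes good: "over_skeleton V E c" and "v \<notin> V" "W \<subseteq> Z"
    and W: "min_pos_degree H - 1 \<le> card W - 1"
  obtains E' c' where "over_skeleton (insert v V) E' c'" "card E' \<le> card E + card W"
proof -
  obtain S where V: "finite V" "Z \<union> Y \<subseteq> V" "E \<subseteq> [V]\<^bsup>2\<^esup>" "[Z]\<^bsup>2\<^esup> \<subseteq> E"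
      "\<And>z y. z \<in> Z \<Longrightarrow> y \<in> Y \<Longrightarrow> {y, z} \<in> E" "[Y]\<^bsup>2\<^esup> \<inter> E = {}" "encoded E c"
    and S: "fillable H V E c S"
      "\<And>v y. v \<in> V - (Z \<union> Y) \<Longrightarrow> y \<in> Y \<Longrightarrow> {v, y} \<in> S"
      "\<And>v z. v \<in> V - (Z \<union> Y) \<Longrightarrow> z \<in> Z \<Longrightarrow> {v, z} \<in> E \<union> S"
    using good unfolding over_skeleton_def by blast
  define E' where "E' = E \<union> (\<lambda>w. {v, w}) ` W"
  \<comment> \<open>On \<open>E\<close> nothing changes, because it was encoded before; the new old
    edges all meet \<open>Z\<close> and receive their codes.\<close>
  define c' where "c' e = (if e \<inter> Z \<noteq> {} then set_encode e else c e)" for e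
  define T where "T = (\<lambda>q. {v, q}) ` (Z - W \<union> Y)"
  have v: "v \<notin> Z" "v \<notin> Y" using assms(2) V(2) by auto
  have WV: "W \<subseteq> V" "v \<notin> W" using V(2) assms(2,3) by auto
  have E'_sub: "E' \<subseteq> [insert v V]\<^bsup>2\<^esup>"
    using V(3) WV nsets_mono[of V "insert v V" 2] by (auto simp: E'_def)
  have new: "{v, x} \<notin> E" "{v, x} \<notin> S" for x
    using V(3) fillable_subset[OF S(1)] assms(2) by (auto dest!: subsetD)
  have S_E': "S \<inter> E' = {}" using fillable_subset[OF S(1)] new by (auto simp: E'_def)
  have c'_c: "c' g = c g" if "g \<in> E" for g
    using that V(7) by (auto simp: c'_def encoded_def)
  have enc: "encoded E' c'" by (auto simp: encoded_def c'_def)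
  have fill: "fillable H (insert v V) E' c' S"
    using fillable_lift[OF S(1) _ _ c'_c S_E' fillable_empty, of "insert v V"] by (auto simp: E'_def)
  have T_sub: "T \<subseteq> [insert v V]\<^bsup>2\<^esup> - E'"
    using V(2) v new assms(3) disjoint_skeleton by (auto simp: T_def E'_def doubleton_eq_iff)
  have "fillable H (insert v V) E' c' (S \<union> T)"
  proof (rule fillable_Un[OF _ fill T_sub])
    show "finite T" using finite_skeleton by (simp add: T_def)
    fix e assume "e \<in> T"
    then obtain q where q: "e = {v, q}" "q \<in> Z - W \<union> Y" by (auto simp: T_def)
    show "addable H (insert v V) E' c' S e"
      unfolding q(1)
    proof (rule addable_via_Z[OF E'_sub enc, of "Z - {q}" W])
      \<comment> \<open>Since \<open>Z\<^sub>2\<close> is nonempty, \<open>Z\<close> without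
        \<open>q\<close> is still at least as large as \<open>Z\<^sub>1\<close>.\<close>
      have "card Z = card Z\<^sub>1 + card Z\<^sub>2"
        using finite_skeleton disjoint_skeleton by (simp add: card_Un_disjoint)
      moreover have "card Z \<le> Suc (card (Z - {q}))" using finite_skeleton by (auto simp: card_Diff_singleton_if)
      moreover have "0 < card Z\<^sub>2" using card_skeleton(2) min_pos_degree_less by linarith
      ultimately show "card (verts H) \<le> card (Z - {q})" using card_skeleton(1) by linarith
      show "{q, a} \<in> E'" if "a \<in> Z - {q}" for a
      proof (cases "q \<in> Y")
        case True
        then show ?thesis using V(5) that by (auto simp: E'_def)
      next
        case False
        then have "{q, a} \<in> [Z]\<^bsup>2\<^esup>" using that q(2) by auto
        then show ?thesis using V(4) by (auto simp: E'_def)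
      qed
      show "[Z - {q}]\<^bsup>2\<^esup> \<subseteq> E'" using V(4) nsets_mono[of "Z - {q}" Z 2] by (auto simp: E'_def)
      show "W \<subseteq> Z - {q}" using q(2) assms(3) disjoint_skeleton by auto
    qed (use V q v assms in \<open>auto simp: E'_def\<close>)
  qed
  moreover have "{u, y} \<in> S \<union> T" if "u \<in> insert v V - (Z \<union> Y)" "y \<in> Y" for u y
    using that S(2)[of u y] by (auto simp: T_def)
  moreover have "{u, z} \<in> E' \<union> (S \<union> T)" if "u \<in> insert v V - (Z \<union> Y)" "z \<in> Z" for u z
    using that S(3)[of u z] unfolding E'_def T_def by blast
  moreover have "[Y]\<^bsup>2\<^esup> \<inter> E' = {}"
    using V(6) v by (auto simp: E'_def)
  moreover have "[Z]\<^bsup>2\<^esup> \<subseteq> E'" "\<forall>z\<in>Z. \<forall>y\<in>Y. {y, z} \<in> E'" "finite (insert v V)" "Z \<union> Y \<subseteq> insert v V"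
    using V by (auto simp: E'_def)
  ultimately have "over_skeleton (insert v V) E' c'"
    unfolding over_skeleton_def using E'_sub enc by blast
  moreover have "card E' \<le> card E + card W"
  proof -
    have "finite W" using assms(3) finite_skeleton finite_subset by blast
    then show ?thesis unfolding E'_def
      using card_Un_le[of E "(\<lambda>w. {v, w}) ` W"] card_image_le[of W "\<lambda>w. {v, w}"] by linarith
  qed
  ultimately show ?thesis using that by blast
qed

text \<open>Each \<open>X\<^sub>i\<close> is joined to the clique \<open>Z\<^sub>i\<close> by old edges, which forces its edges to the rest of
  the skeleton. Any other vertex of the block then shares with each skeleton vertex a large set of
  neighbours in \<open>B\<^sub>1\<close> or \<open>B\<^sub>2\<close> to which both are joined by added edges only.\<close>

lemma over_skeleton_add_block:
  assumes good: "over_skeleton V E c"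
    and block: "fillable H U F b ([U]\<^bsup>2\<^esup> - F)" "F \<subseteq> [U]\<^bsup>2\<^esup>" "finite U" "U \<inter> V = {}"
    and X: "X\<^sub>1 \<subseteq> U" "X\<^sub>2 \<subseteq> U" "X\<^sub>1 \<inter> X\<^sub>2 = {}" "B\<^sub>1 \<subseteq> X\<^sub>1" "B\<^sub>2 \<subseteq> X\<^sub>2"
    and B: "[B\<^sub>1]\<^bsup>2\<^esup> \<inter> F = {}" "[B\<^sub>2]\<^bsup>2\<^esup> \<inter> F = {}"
    and card_B: "\<And>x. x \<in> U - (X\<^sub>1 \<union> X\<^sub>2) \<Longrightarrow> card (verts H) \<le> card {w \<in> B\<^sub>1. {x, w} \<notin> F}"
      "\<And>x. x \<in> U - (X\<^sub>1 \<union> X\<^sub>2) \<Longrightarrow> card (verts H) \<le> card {w \<in> B\<^sub>2. {x, w} \<notin> F}"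
  obtains E' c' where "over_skeleton (V \<union> U) E' c'"
    "card E' \<le> card E + card F + card X\<^sub>1 * card Z\<^sub>1 + card X\<^sub>2 * card Z\<^sub>2"
proof -
  obtain S where V: "finite V" "Z \<union> Y \<subseteq> V" "E \<subseteq> [V]\<^bsup>2\<^esup>" "[Z]\<^bsup>2\<^esup> \<subseteq> E"
      "\<And>z y. z \<in> Z \<Longrightarrow> y \<in> Y \<Longrightarrow> {y, z} \<in> E" "[Y]\<^bsup>2\<^esup> \<inter> E = {}" "encoded E c"
    and S: "fillable H V E c S"
      "\<And>v y. v \<in> V - (Z \<union> Y) \<Longrightarrow> y \<in> Y \<Longrightarrow> {v, y} \<in> S"
      "\<And>v z. v \<in> V - (Z \<union> Y) \<Longrightarrow> z \<in> Z \<Longrightarrow> {v, z} \<in> E \<union> S"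
    using good unfolding over_skeleton_def by blast
  define J where "J X A = {{x, z} |x z. x \<in> X \<and> z \<in> A}" for X A :: "nat set"
  define E' where "E' = E \<union> F \<union> J X\<^sub>1 Z\<^sub>1 \<union> J X\<^sub>2 Z\<^sub>2"
  \<comment> \<open>Edges inside \<open>U\<close> avoid \<open>Z\<close> and keep the block colors,
    while the edges of \<open>E\<close> keep theirs. The color sets may overlap, since no copy used
    below mixes old edges from both sides.\<close>
  define c' where "c' e = (if e \<inter> Z \<noteq> {} then set_encode e else if e \<subseteq> U then b e else c e)" for e
  define L where "L = U - (X\<^sub>1 \<union> X\<^sub>2)"
  define T\<^sub>1 where "T\<^sub>1 = J X\<^sub>1 (Z\<^sub>2 \<union> Y) \<union> J X\<^sub>2 (Z\<^sub>1 \<union> Y)"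
  define T\<^sub>2 where "T\<^sub>2 = J L (Z \<union> Y)"
  let ?V = "V \<union> U" and ?R = "[U]\<^bsup>2\<^esup> - F"
  have UZ: "x \<notin> U" "x \<in> V" if "x \<in> Z \<union> Y" for x using that V(2) block(4) by auto
  have VU: "x \<notin> V" if "x \<in> U" for x using that block(4) by auto
  have cross: "{x, q} \<in> J X A \<longleftrightarrow> x \<in> X \<and> q \<in> A" if "x \<in> U" "q \<in> V" "X \<subseteq> U" "A \<subseteq> V" for x q X A
    using that VU by (auto simp: J_def doubleton_eq_iff)
  have cross_E': "{x, q} \<in> E' \<longleftrightarrow> x \<in> X\<^sub>1 \<and> q \<in> Z\<^sub>1 \<or> x \<in> X\<^sub>2 \<and> q \<in> Z\<^sub>2" if "x \<in> U" "q \<in> V" for x q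
  proof -
    have "{x, q} \<notin> E" using V(3) VU[OF that(1)] by (auto dest!: subsetD)
    moreover have "{x, q} \<notin> F" using block(2,4) that(2) by (auto dest!: subsetD)
    ultimately show ?thesis
      unfolding E'_def using cross[OF that X(1), of Z\<^sub>1] cross[OF that X(2), of Z\<^sub>2] V(2) by auto
  qed
  have J_sub: "J X A \<subseteq> [?V]\<^bsup>2\<^esup>" if "X \<subseteq> U" "A \<subseteq> V" for X A
    using subsetD[OF that(1)] subsetD[OF that(2)] VU by (fastforce simp: J_def)
  have J_U: "J X A \<inter> [U]\<^bsup>2\<^esup> = {}" if "A \<subseteq> V" for X A
    using subsetD[OF that] VU by (fastforce simp: J_def)
  have J_V: "J X A \<inter> [V]\<^bsup>2\<^esup> = {}" if "X \<subseteq> U" for X A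
    using subsetD[OF that] VU by (fastforce simp: J_def)
  have UV: "[U]\<^bsup>2\<^esup> \<inter> [V]\<^bsup>2\<^esup> = {}" using block(4) by (auto simp: nsets_2_eq doubleton_eq_iff)
  have Z: "Z\<^sub>1 \<subseteq> V" "Z\<^sub>2 \<subseteq> V" "Y \<subseteq> V" using V(2) by auto
  have E'_sub: "E' \<subseteq> [?V]\<^bsup>2\<^esup>"
    unfolding E'_def
    using V(3) block(2) J_sub[OF X(1) Z(1)] J_sub[OF X(2) Z(2)] nsets_mono[of V ?V 2] nsets_mono[of U ?V 2]
    by blast
  have enc: "encoded E' c'" by (auto simp: encoded_def c'_def)
  have c'_c: "c' g = c g" if "g \<in> E" for g
  proof -
    have "\<not> g \<subseteq> U" using that V(3) block(4) by (auto simp: nsets_2_eq)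
    then show ?thesis using that V(7) by (auto simp: c'_def encoded_def)
  qed
  have c'_b: "c' g = b g" if "g \<in> F" for g
  proof -
    have "g \<subseteq> U" using that block(2) by (auto simp: nsets_def)
    then show ?thesis using UZ(1) by (auto simp: c'_def)
  qed
  have S_E': "S \<inter> E' = {}"
    unfolding E'_def
    using fillable_subset[OF S(1)] block(2) UV J_V[OF X(1), of Z\<^sub>1] J_V[OF X(2), of Z\<^sub>2] by blast
  have "?R \<inter> E' = {}"
    unfolding E'_def using V(3) UV J_U[OF Z(1), of X\<^sub>1] J_U[OF Z(2), of X\<^sub>2] by blast
  moreover have "fillable H ?V E' c' S"
    using fillable_lift[OF S(1) _ _ c'_c S_E' fillable_empty, of ?V] by (auto simp: E'_def)
  \<comment> \<open>The entire filling of the block is replayed in the merged graph.\<close>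
  ultimately have fill1: "fillable H ?V E' c' (S \<union> ?R)"
    by (intro fillable_lift[OF block(1)]) (auto simp: E'_def c'_b)
  have ZE': "[Z]\<^bsup>2\<^esup> \<subseteq> E'" "\<And>z y. z \<in> Z \<Longrightarrow> y \<in> Y \<Longrightarrow> {y, z} \<in> E'" using V(4,5) by (auto simp: E'_def)
  have via_Z: "addable H ?V E' c' (S \<union> ?R) {x, q}"
    if XA: "(X, A) \<in> {(X\<^sub>1, Z\<^sub>1), (X\<^sub>2, Z\<^sub>2)}" and x: "x \<in> X" and q: "q \<in> (Z \<union> Y) - A" for X A x q
  proof (rule addable_via_Z[OF E'_sub enc, of A A])
    have "card (verts H) \<le> card A" using XA card_skeleton by auto
    then show "card (verts H) \<le> card A" "min_pos_degree H - 1 \<le> card A - 1"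
      using min_pos_degree_less by linarith+
    have "x \<in> U" using XA x X by auto
    then show "x \<in> ?V - A" "x \<noteq> q" using XA q UZ by auto
    show A: "A \<subseteq> Z" using XA by auto
    then show "[A]\<^bsup>2\<^esup> \<subseteq> E'" using ZE'(1) nsets_mono[of A Z 2] by blast
    show "A \<subseteq> ?V" "q \<in> ?V - A" using A UZ(2) q by auto
    show "{x, a} \<in> E'" if "a \<in> A" for a
      using cross_E'[OF \<open>x \<in> U\<close>, of a] XA that x UZ(2)[of a] by auto
    show "{q, a} \<in> E'" if "a \<in> A" for a
    proof (cases "q \<in> Y")
      case False
      then have "{q, a} \<in> [Z]\<^bsup>2\<^esup>" using that q A by auto
      then show ?thesis using ZE'(1) by auto
    qed (use ZE'(2) that A in auto)
  qed auto
  have T\<^sub>1: "T\<^sub>1 \<subseteq> [?V]\<^bsup>2\<^esup> - E'"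
  proof
    fix e assume "e \<in> T\<^sub>1"
    then obtain x q where e: "e = {x, q}" "x \<in> X\<^sub>1 \<and> q \<in> Z\<^sub>2 \<union> Y \<or> x \<in> X\<^sub>2 \<and> q \<in> Z\<^sub>1 \<union> Y"
      by (auto simp: T\<^sub>1_def J_def)
    then have xq: "x \<in> U" "q \<in> V" using X V(2) by auto
    then have "{x, q} \<notin> E'" using cross_E'[OF xq] e(2) X(3) disjoint_skeleton by auto
    then show "e \<in> [?V]\<^bsup>2\<^esup> - E'" using xq VU e(1) by auto
  qed
  have T\<^sub>2: "T\<^sub>2 \<subseteq> [?V]\<^bsup>2\<^esup> - E'"
  proof
    fix e assume "e \<in> T\<^sub>2"
    then obtain x q where e: "e = {x, q}" "x \<in> L" "q \<in> Z \<union> Y" by (auto simp: T\<^sub>2_def J_def)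
    then have xq: "x \<in> U" "q \<in> V" using V(2) by (auto simp: L_def)
    then have "{x, q} \<notin> E'" using cross_E'[OF xq] e(2) by (auto simp: L_def)
    then show "e \<in> [?V]\<^bsup>2\<^esup> - E'" using xq VU e(1) by auto
  qed
  have "finite ([?V]\<^bsup>2\<^esup>)" using V(1) block(3) by (simp add: finite_imp_finite_nsets)
  then have fin: "finite T\<^sub>1" "finite T\<^sub>2" using T\<^sub>1 T\<^sub>2 finite_subset by blast+
  have fill2: "fillable H ?V E' c' (S \<union> ?R \<union> T\<^sub>1)"
  proof (rule fillable_Un[OF fin(1) fill1 T\<^sub>1])
    fix e assume "e \<in> T\<^sub>1"
    then obtain x q where "e = {x, q}" "x \<in> X\<^sub>1 \<and> q \<in> Z\<^sub>2 \<union> Y \<or> x \<in> X\<^sub>2 \<and> q \<in> Z\<^sub>1 \<union> Y"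
      by (auto simp: T\<^sub>1_def J_def)
    then show "addable H ?V E' c' (S \<union> ?R) e"
      using via_Z[of X\<^sub>1 Z\<^sub>1 x q] via_Z[of X\<^sub>2 Z\<^sub>2 x q] disjoint_skeleton by auto
  qed
  \<comment> \<open>The non-neighbours of \<open>x\<close> in \<open>B\<close> are joined to
    \<open>x\<close> and to each other by edges added within the block, and to \<open>q\<close> by
    edges of \<open>T\<^sub>1\<close>, so the copy has no old edge.\<close>
  have via_B: "addable H ?V E' c' (S \<union> ?R \<union> T\<^sub>1) {x, q}"
    if "B \<subseteq> U" "[B]\<^bsup>2\<^esup> \<inter> F = {}" "card (verts H) \<le> card {w \<in> B. {x, w} \<notin> F}" "x \<in> U - B" "q \<in> V"
      "\<And>w. w \<in> B \<Longrightarrow> {w, q} \<in> T\<^sub>1" for B x q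
  proof (rule addable_by_added_edges[of "{w \<in> B. {x, w} \<notin> F}"])
    show "finite {w \<in> B. {x, w} \<notin> F}" using that(1) block(3) finite_subset by fastforce
    show "[{w \<in> B. {x, w} \<notin> F}]\<^bsup>2\<^esup> \<subseteq> S \<union> ?R \<union> T\<^sub>1"
      using that(1,2) nsets_mono[of "{w \<in> B. {x, w} \<notin> F}" B 2] nsets_mono[of B U 2] by blast
    show "{q, w} \<in> S \<union> ?R \<union> T\<^sub>1" if "w \<in> {w \<in> B. {x, w} \<notin> F}" for w
      using that \<open>\<And>w. w \<in> B \<Longrightarrow> {w, q} \<in> T\<^sub>1\<close>[of w] by (auto simp: insert_commute)
    show "q \<in> ?V - {w \<in> B. {x, w} \<notin> F}" "x \<noteq> q" using that(1,4,5) block(4) by auto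
  qed (use that in auto)
  have "fillable H ?V E' c' (S \<union> ?R \<union> T\<^sub>1 \<union> T\<^sub>2)"
  proof (rule fillable_Un[OF fin(2) fill2 T\<^sub>2])
    fix e assume "e \<in> T\<^sub>2"
    then obtain x q where e: "e = {x, q}" "x \<in> L" "q \<in> Z \<union> Y" by (auto simp: T\<^sub>2_def J_def)
    then have x: "x \<in> U - B\<^sub>1" "x \<in> U - B\<^sub>2" "x \<in> U - (X\<^sub>1 \<union> X\<^sub>2)" using X by (auto simp: L_def)
    have q: "q \<in> V" using UZ(2)[OF e(3)] .
    have B_U: "B\<^sub>1 \<subseteq> U" "B\<^sub>2 \<subseteq> U" using X by auto
    show "addable H ?V E' c' (S \<union> ?R \<union> T\<^sub>1) e"
    \<comment> \<open>\<open>B\<^sub>1\<close> is joined to \<open>Z\<^sub>2\<close> and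
      \<open>Y\<close> by added edges, \<open>B\<^sub>2\<close> to \<open>Z\<^sub>1\<close> and
      \<open>Y\<close>; together they serve every skeleton vertex.\<close>
    proof (cases "q \<in> Z\<^sub>2")
      case True
      then have "{w, q} \<in> T\<^sub>1" if "w \<in> B\<^sub>1" for w
        using that X(4) by (auto simp: T\<^sub>1_def J_def)
      then show ?thesis
        unfolding e(1) by (rule via_B[OF B_U(1) B(1) card_B(1)[OF x(3)] x(1) q])
    next
      case False
      then have "{w, q} \<in> T\<^sub>1" if "w \<in> B\<^sub>2" for w
        using that X(5) e(3) by (auto simp: T\<^sub>1_def J_def)
      then show ?thesis
        unfolding e(1) by (rule via_B[OF B_U(2) B(2) card_B(2)[OF x(3)] x(2) q])
    qed
  qed
  moreover have "{u, y} \<in> S \<union> ?R \<union> T\<^sub>1 \<union> T\<^sub>2" if "u \<in> ?V - (Z \<union> Y)" "y \<in> Y" for u y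
    using that S(2)[of u y] unfolding T\<^sub>1_def T\<^sub>2_def L_def J_def by blast
  moreover have "{u, z} \<in> E' \<union> (S \<union> ?R \<union> T\<^sub>1 \<union> T\<^sub>2)" if "u \<in> ?V - (Z \<union> Y)" "z \<in> Z" for u z
    using that S(3)[of u z] unfolding E'_def T\<^sub>1_def T\<^sub>2_def L_def J_def by blast
  moreover have "[Y]\<^bsup>2\<^esup> \<inter> E' = {}"
  proof -
    have "[Y]\<^bsup>2\<^esup> \<subseteq> [V]\<^bsup>2\<^esup>" using Z(3) by (rule nsets_mono)
    then show ?thesis
      unfolding E'_def
      using V(6) block(2) UV J_V[OF X(1), of Z\<^sub>1] J_V[OF X(2), of Z\<^sub>2] by blast
  qed
  moreover have "finite ?V" "Z \<union> Y \<subseteq> ?V" using V(1,2) block(3) by auto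
  ultimately have "over_skeleton ?V E' c'"
    unfolding over_skeleton_def using E'_sub enc ZE' by blast
  moreover have "card E' \<le> card E + card F + card X\<^sub>1 * card Z\<^sub>1 + card X\<^sub>2 * card Z\<^sub>2"
  proof -
    have "finite X\<^sub>1" "finite X\<^sub>2" using X block(3) finite_subset by blast+
    then have "card (J X\<^sub>1 Z\<^sub>1) \<le> card X\<^sub>1 * card Z\<^sub>1" "card (J X\<^sub>2 Z\<^sub>2) \<le> card X\<^sub>2 * card Z\<^sub>2"
      unfolding J_def using finite_skeleton by (auto intro: card_join_le)
    then show ?thesis
      unfolding E'_def
      using card_Un_le[of "E \<union> F \<union> J X\<^sub>1 Z\<^sub>1" "J X\<^sub>2 Z\<^sub>2"] card_Un_le[of "E \<union> F" "J X\<^sub>1 Z\<^sub>1"] card_Un_le[of E F]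
      by linarith
  qed
  ultimately show ?thesis using that by blast
qed

end

section \<open>Lower and upper bounds\<close>

context nonempty_graph
begin

text \<open>The complete graph is saturated vacuously, so the default value in \<open>rwsat\<close>
  never occurs.\<close>

lemma rwsat_in_saturated_sizes: "rwsat n H \<in> saturated_sizes n H"
proof -
  let ?G = "\<lparr>verts = {..<n}, edges = [{..<n}]\<^bsup>2\<^esup>\<rparr> :: nat sgraph"
  have "weakly_rainbow_saturated H ?G c" for c
    by (simp add: weakly_rainbow_saturated_iff_fillable[OF fsg] fillable_empty)
  moreover have "finite_simple_graph ?G" by (simp add: finite_simple_graph_def)
  ultimately have "card (edges ?G) \<in> saturated_sizes n H"
    unfolding saturated_sizes_def mem_Collect_eq by (intro exI[of _ ?G] exI) auto
  then have "saturated_sizes n H \<noteq> {}" by blast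
  then show ?thesis unfolding rwsat_def using LeastI_ex[of "\<lambda>m. m \<in> saturated_sizes n H"] by auto
qed

lemma rwsat_attained:
  obtains U :: "nat set" and F b where "finite U" "card U = n" "F \<subseteq> [U]\<^bsup>2\<^esup>" "card F = rwsat n H"
    "fillable H U F b ([U]\<^bsup>2\<^esup> - F)"
proof -
  obtain G :: "nat sgraph" and c where G: "card (edges G) = rwsat n H" "finite_simple_graph G"
      "card (verts G) = n" "weakly_rainbow_saturated H G c"
    using rwsat_in_saturated_sizes[of n] unfolding saturated_sizes_def mem_Collect_eq by metis
  show ?thesis
    by (rule that[of "verts G" "edges G" c])
      (use G in \<open>auto simp: finite_simple_graph_def weakly_rainbow_saturated_iff_fillable[OF fsg]\<close>)
qed

text \<open>Coloring the first edge added at \<open>v\<close> like an old edge at \<open>v\<close> leaves too few colors for a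
  rainbow star at \<open>v\<close> if \<open>v\<close> has degree less than the minimum positive degree of \<open>H\<close>.\<close>

lemma min_pos_degree_le_degree_saturated:
  fixes V :: "nat set"
  assumes "finite V" "E \<subseteq> [V]\<^bsup>2\<^esup>" "fillable H V E c ([V]\<^bsup>2\<^esup> - E)" "v \<in> V"
    and "2 \<le> min_pos_degree H" "min_pos_degree H < card V"
  shows "min_pos_degree H \<le> card {e \<in> E. v \<in> e}"
proof (rule ccontr)
  assume less: "\<not> min_pos_degree H \<le> card {e \<in> E. v \<in> e}"
  have "finite E" using assms(1,2) finite_imp_finite_nsets finite_subset by blast
  let ?D = "{e \<in> E. v \<in> e}"
  \<comment> \<open>The degree of \<open>v\<close> is less than \<open>min_pos_degree H\<close>,
    hence less than \<open>card V - 1\<close>, and some edge at \<open>v\<close> is missing.\<close>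
  have "card {w \<in> V - {v}. {v, w} \<in> E} < card (V - {v})"
    using card_neighbours_le[OF \<open>finite E\<close>, of "V - {v}" v] less assms(1,4,6) by simp
  then have "\<not> V - {v} \<subseteq> {w \<in> V - {v}. {v, w} \<in> E}"
    using card_mono[of "{w \<in> V - {v}. {v, w} \<in> E}" "V - {v}"] assms(1) by fastforce
  then obtain w where "w \<in> V - {v}" "{v, w} \<notin> E" by blast
  then have "{v, w} \<in> [V]\<^bsup>2\<^esup> - E" using assms(4) by auto
  then have "\<exists>e\<in>[V]\<^bsup>2\<^esup> - E. v \<in> e" by blast
  from fillable_first_edge_at[OF assms(3) this]
  obtain T e where T: "addable H V E c T e" "T \<subseteq> [V]\<^bsup>2\<^esup> - E" "e \<in> [V]\<^bsup>2\<^esup> - E - T" "v \<in> e"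
      "\<forall>g\<in>T. v \<notin> g" by blast
  define g where "g = (SOME g. g \<in> ?D)"
  \<comment> \<open>The first edge added at \<open>v\<close> repeats the color of the old edge
    \<open>g\<close>. All other added edges get injective codes shifted above \<open>c g\<close>, so
    the added edges have distinct colors.\<close>
  define col where "col x = (if x \<in> E then c x else if x = e then c g else Suc (c g + set_encode x))" for x
  have fin: "finite x" if "x \<in> insert e T" for x using that T(2,3) by (auto simp: nsets_def)
  have "inj_on col (insert e T)"
  proof (rule inj_onI)
    fix x y assume xy: "x \<in> insert e T" "y \<in> insert e T" "col x = col y"
    have "x \<notin> E" "y \<notin> E" using xy T(2,3) by auto
    then show "x = y"
      using xy fin[OF xy(1)] fin[OF xy(2)] by (auto simp: col_def set_encode_eq split: if_splits)
  qed
  then obtain f where f: "rainbow_embedding H V (insert e (E \<union> T)) col e f"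
    using T(1) unfolding addable_def by (force simp: col_def)
  then obtain e\<^sub>0 where "e\<^sub>0 \<in> edges H" "e = f ` e\<^sub>0" unfolding rainbow_embedding_def by blast
  then obtain u where u: "u \<in> e\<^sub>0" "f u = v" using T(4) by auto
  have "u \<in> verts H" using u(1) \<open>e\<^sub>0 \<in> edges H\<close> edges_subset by (auto simp: nsets_def)
  let ?K = "(`) f ` {k \<in> edges H. u \<in> k}"
  have inj_f: "inj_on ((`) f) (edges H)"
  proof (rule inj_on_subset[OF inj_on_image_Pow])
    show "inj_on f (verts H)" using f by (simp add: rainbow_embedding_def)
    show "edges H \<subseteq> Pow (verts H)" using edges_subset by (auto simp: nsets_def)
  qed
  have "card ?K = degree H u"
    unfolding degree_def by (intro card_image inj_on_subset[OF inj_f]) auto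
  moreover have "min_pos_degree H \<le> degree H u"
    using min_pos_degree_le degree_pos[OF \<open>e\<^sub>0 \<in> edges H\<close> u(1)] \<open>u \<in> verts H\<close> by simp
  moreover have K_sub: "?K \<subseteq> insert e ?D"
  proof
    fix x assume x: "x \<in> ?K"
    then have "x \<in> (`) f ` edges H" by blast
    then have "x \<in> insert e (E \<union> T)" using f unfolding rainbow_embedding_def by (meson subsetD)
    moreover have "v \<in> x" using x u(2) by auto
    ultimately show "x \<in> insert e ?D" using T(5) by auto
  qed
  moreover have fin_D: "finite (insert e ?D)" using \<open>finite E\<close> by simp
  moreover have card_D: "card (insert e ?D) = Suc (card ?D)" using T(3) \<open>finite E\<close> by simp
  \<comment> \<open>The copy has at least \<open>min_pos_degree H\<close> edges at \<open>v\<close>,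
    and fewer old ones exist there. It must use all of them together with \<open>e\<close>.\<close>
  ultimately have "card (insert e ?D) \<le> card ?K" using less by linarith
  then have K: "?K = insert e ?D" using K_sub fin_D by (metis card_seteq)
  \<comment> \<open>Here the minimum positive degree must be at least 2: without old edges at
    \<open>v\<close> the copy would have only \<open>e\<close> there. Now the choice of
    \<open>g\<close> is justified.\<close>
  have "?D \<noteq> {}"
  proof
    assume D: "?D = {}"
    have "card ?K = 1" unfolding K D by simp
    then show False
      using \<open>card ?K = degree H u\<close> \<open>min_pos_degree H \<le> degree H u\<close> assms(5) by linarith
  qed
  then have "g \<in> ?D" unfolding g_def by (metis some_in_eq)
  then have "g \<in> ?K" "e \<in> ?K" unfolding K by auto
  moreover have "inj_on col ?K"
    using f unfolding rainbow_embedding_def by (elim conjE inj_on_subset) auto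
  moreover have "col g = col e" using \<open>g \<in> ?D\<close> T(3) by (auto simp: col_def)
  ultimately have "g = e" by (auto dest: inj_onD)
  then show False using \<open>g \<in> ?D\<close> T(3) by simp
qed

lemma rwsat_lower_bound:
  assumes "2 \<le> min_pos_degree H" "min_pos_degree H < n"
  shows "min_pos_degree H * n \<le> 2 * rwsat n H"
proof -
  obtain V :: "nat set" and E c where G: "finite V" "card V = n" "E \<subseteq> [V]\<^bsup>2\<^esup>" "card E = rwsat n H"
    "fillable H V E c ([V]\<^bsup>2\<^esup> - E)" by (rule rwsat_attained[of n])
  have "min_pos_degree H * n = (\<Sum>v\<in>V. min_pos_degree H)" using G(2) by simp
  also have "\<dots> \<le> (\<Sum>v\<in>V. card {e \<in> E. v \<in> e})"
    by (intro sum_mono min_pos_degree_le_degree_saturated[OF G(1,3,5)]) (use assms G(2) in auto)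
  also have "\<dots> = 2 * rwsat n H" using sum_card_incident[OF G(1,3)] G(4) by simp
  finally show ?thesis .
qed

end

section \<open>Linear upper bounds and gluing of blocks\<close>

context skeleton
begin

text \<open>By truncated subtraction the condition on \<open>d\<close> admits
  \<open>d = min_pos_degree H\<close> and, if this is 1, also \<open>d = 0\<close>.\<close>

lemma over_skeleton_add_vertices:
  assumes "over_skeleton V E c" "min_pos_degree H - 1 \<le> d - 1" "d \<le> card Z"
  shows "\<exists>V' E' c'. over_skeleton V' E' c' \<and> card V' = card V + r \<and> card E' \<le> card E + r * d"
proof (induction r)
  case 0
  show ?case using assms(1) by auto
next
  case (Suc r)
  then obtain V' E' c' where G: "over_skeleton V' E' c'" "card V' = card V + r"
    "card E' \<le> card E + r * d" by blast
  have "finite V'" using G(1) by (simp add: over_skeleton_def)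
  then obtain v where v: "v \<notin> V'" using ex_new_if_finite[OF infinite_UNIV_nat] by blast
  obtain W where W: "W \<subseteq> Z" "card W = d" using obtain_subset_with_card_n[OF assms(3)] by metis
  obtain E'' c'' where "over_skeleton (insert v V') E'' c''" "card E'' \<le> card E' + card W"
    using over_skeleton_add_vertex[OF G(1) v W(1)] assms(2) W(2) by metis
  then show ?case
    using G W v \<open>finite V'\<close> by (intro exI[of _ "insert v V'"] exI[of _ E''] exI[of _ c'']) auto
qed

text \<open>The block is shifted beyond the largest element of \<open>V\<close>, so that the same
  block can be glued repeatedly.\<close>

lemma over_skeleton_add_disjoint_copy:
  fixes U :: "nat set"
  assumes good: "over_skeleton V E c"
    and block: "fillable H U F b ([U]\<^bsup>2\<^esup> - F)" "F \<subseteq> [U]\<^bsup>2\<^esup>" "finite U"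
    and X: "X\<^sub>1 \<subseteq> U" "X\<^sub>2 \<subseteq> U" "X\<^sub>1 \<inter> X\<^sub>2 = {}" "B\<^sub>1 \<subseteq> X\<^sub>1" "B\<^sub>2 \<subseteq> X\<^sub>2"
    and B: "[B\<^sub>1]\<^bsup>2\<^esup> \<inter> F = {}" "[B\<^sub>2]\<^bsup>2\<^esup> \<inter> F = {}"
    and card_B: "\<And>x. x \<in> U - (X\<^sub>1 \<union> X\<^sub>2) \<Longrightarrow> card (verts H) \<le> card {w \<in> B\<^sub>1. {x, w} \<notin> F}"
      "\<And>x. x \<in> U - (X\<^sub>1 \<union> X\<^sub>2) \<Longrightarrow> card (verts H) \<le> card {w \<in> B\<^sub>2. {x, w} \<notin> F}"
  obtains V' E' c' where "over_skeleton V' E' c'" "card V' = card V + card U"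
    "card E' \<le> card E + (card F + (card X\<^sub>1 + card X\<^sub>2) * card Z)"
proof -
  have "finite V" using good by (simp add: over_skeleton_def)
  define \<phi> :: "nat \<Rightarrow> nat" where "\<phi> x = x + Suc (Max (insert 0 V))" for x
  have inj: "inj \<phi>" by (auto simp: \<phi>_def inj_def)
  have inj_on: "inj_on \<phi> A" for A using inj by (rule inj_on_subset) simp
  have inj_img: "inj ((`) \<phi>)" using inj by (auto intro!: injI simp: inj_image_eq_iff)
  have fresh: "\<phi> ` U \<inter> V = {}"
  proof -
    have "x \<le> Max (insert 0 V)" if "x \<in> V" for x using that \<open>finite V\<close> by (intro Max_ge) auto
    then show ?thesis by (fastforce simp: \<phi>_def)
  qed
  let ?F = "(`) \<phi> ` F" and ?b = "\<lambda>g. b (\<phi> -` g)"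
  have img_nsets: "(`) \<phi> ` [A]\<^bsup>2\<^esup> = [\<phi> ` A]\<^bsup>2\<^esup>" for A
    using bij_betw_nsets[of \<phi> A "\<phi> ` A" 2] inj_on by (auto simp: bij_betw_def)
  have mem_F: "{\<phi> x, \<phi> y} \<in> ?F \<longleftrightarrow> {x, y} \<in> F" for x y
    using inj_image_mem_iff[OF inj_img, of "{x, y}" F] by simp
  have "fillable H (\<phi> ` U) ?F ?b ((`) \<phi> ` ([U]\<^bsup>2\<^esup> - F))"
  proof (rule fillable_image[OF block(1) inj_on])
    show "F \<subseteq> Pow U" using block(2) by (auto simp: nsets_def)
    show "edges H \<subseteq> Pow (verts H)" using edges_subset by (auto simp: nsets_def)
    show "b (\<phi> -` \<phi> ` g) = b g" for g using inj by (simp add: inj_vimage_image_eq)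
  qed
  then have fill: "fillable H (\<phi> ` U) ?F ?b ([\<phi> ` U]\<^bsup>2\<^esup> - ?F)"
    using image_set_diff[OF inj_img] img_nsets by simp
  have indep: "[\<phi> ` A]\<^bsup>2\<^esup> \<inter> ?F = {}" if "[A]\<^bsup>2\<^esup> \<inter> F = {}" for A
    using that image_Int[OF inj_img, of "[A]\<^bsup>2\<^esup>" F] img_nsets by simp
  have non_nbrs: "card {w \<in> \<phi> ` A. {\<phi> x, w} \<notin> ?F} = card {w \<in> A. {x, w} \<notin> F}" for x A
  proof -
    have "{w \<in> \<phi> ` A. {\<phi> x, w} \<notin> ?F} = \<phi> ` {w \<in> A. {x, w} \<notin> F}" using mem_F by auto
    then show ?thesis by (simp add: card_image inj_on)
  qed
  have U_diff: "\<phi> ` U - (\<phi> ` X\<^sub>1 \<union> \<phi> ` X\<^sub>2) = \<phi> ` (U - (X\<^sub>1 \<union> X\<^sub>2))"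
    by (simp add: image_set_diff[OF inj] image_Un)
  have card_B': "card (verts H) \<le> card {w \<in> \<phi> ` B\<^sub>1. {x, w} \<notin> ?F}"
      "card (verts H) \<le> card {w \<in> \<phi> ` B\<^sub>2. {x, w} \<notin> ?F}"
    if "x \<in> \<phi> ` U - (\<phi> ` X\<^sub>1 \<union> \<phi> ` X\<^sub>2)" for x
  proof -
    obtain x' where "x' \<in> U - (X\<^sub>1 \<union> X\<^sub>2)" "x = \<phi> x'"
      using \<open>x \<in> _\<close> unfolding U_diff by (metis imageE)
    then show "card (verts H) \<le> card {w \<in> \<phi> ` B\<^sub>1. {x, w} \<notin> ?F}"
      "card (verts H) \<le> card {w \<in> \<phi> ` B\<^sub>2. {x, w} \<notin> ?F}"
      using card_B by (simp_all add: non_nbrs)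
  qed
  have F_sub: "?F \<subseteq> [\<phi> ` U]\<^bsup>2\<^esup>" using block(2) img_nsets by blast
  have X': "\<phi> ` X\<^sub>1 \<subseteq> \<phi> ` U" "\<phi> ` X\<^sub>2 \<subseteq> \<phi> ` U" "\<phi> ` X\<^sub>1 \<inter> \<phi> ` X\<^sub>2 = {}"
      "\<phi> ` B\<^sub>1 \<subseteq> \<phi> ` X\<^sub>1" "\<phi> ` B\<^sub>2 \<subseteq> \<phi> ` X\<^sub>2"
    using X by (auto simp flip: image_Int[OF inj])
  obtain E' c' where G: "over_skeleton (V \<union> \<phi> ` U) E' c'"
      "card E' \<le> card E + card ?F + card (\<phi> ` X\<^sub>1) * card Z\<^sub>1 + card (\<phi> ` X\<^sub>2) * card Z\<^sub>2"
    by (rule over_skeleton_add_block[OF good fill F_sub finite_imageI[OF block(3)] fresh X'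
          indep[OF B(1)] indep[OF B(2)] card_B'])
  have "card Z\<^sub>1 \<le> card Z" "card Z\<^sub>2 \<le> card Z" using finite_skeleton by (auto intro: card_mono)
  then have "card X\<^sub>1 * card Z\<^sub>1 + card X\<^sub>2 * card Z\<^sub>2 \<le> (card X\<^sub>1 + card X\<^sub>2) * card Z"
    unfolding add_mult_distrib by (intro add_mono mult_left_mono) auto
  moreover have "card ?F = card F" using inj_img by (auto intro: card_image inj_on_subset)
  ultimately have "card E' \<le> card E + (card F + (card X\<^sub>1 + card X\<^sub>2) * card Z)"
    using G(2) by (simp add: card_image inj_on)
  moreover have "card (V \<union> \<phi> ` U) = card V + card U"
    using \<open>finite V\<close> block(3) fresh by (subst card_Un_disjoint) (auto simp: card_image inj_on)
  ultimately show ?thesis using that G(1) by blast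
qed

lemma rwsat_le_linear:
  assumes "min_pos_degree H - 1 \<le> d - 1" "d \<le> card Z"
  shows "\<exists>C. \<forall>n\<ge>card (Z \<union> Y). rwsat n H \<le> d * n + C"
proof -
  obtain E c where E: "over_skeleton (Z \<union> Y) E c" by (rule over_skeleton_base)
  have "rwsat n H \<le> d * n + card E" if n: "card (Z \<union> Y) \<le> n" for n
  proof -
    let ?r = "n - card (Z \<union> Y)"
    obtain V' E' c' where G: "over_skeleton V' E' c'" "card V' = card (Z \<union> Y) + ?r"
        "card E' \<le> card E + ?r * d"
      using over_skeleton_add_vertices[OF E assms] by blast
    have "?r * d \<le> n * d" by (intro mult_right_mono) auto
    then have "?r * d \<le> d * n" by (simp only: mult.commute)
    moreover have "card V' = n" using G(2) n by simp
    then have "rwsat n H \<le> card E'" using rwsat_le_over_skeleton[OF G(1)] by simp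
    ultimately show ?thesis using G(3) by linarith
  qed
  then show ?thesis by blast
qed

text \<open>As many copies of the block as fit are glued to the skeleton. Fewer than
  \<open>card U\<close> vertices remain; they are attached singly at the cost of
  \<open>card Z\<close> edges each, which goes into the constant.\<close>

lemma rwsat_le_blocks:
  fixes U :: "nat set"
  assumes block: "fillable H U F b ([U]\<^bsup>2\<^esup> - F)" "F \<subseteq> [U]\<^bsup>2\<^esup>" "finite U" "U \<noteq> {}"
    and X: "X\<^sub>1 \<subseteq> U" "X\<^sub>2 \<subseteq> U" "X\<^sub>1 \<inter> X\<^sub>2 = {}" "B\<^sub>1 \<subseteq> X\<^sub>1" "B\<^sub>2 \<subseteq> X\<^sub>2"
    and B: "[B\<^sub>1]\<^bsup>2\<^esup> \<inter> F = {}" "[B\<^sub>2]\<^bsup>2\<^esup> \<inter> F = {}"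
    and card_B: "\<And>x. x \<in> U - (X\<^sub>1 \<union> X\<^sub>2) \<Longrightarrow> card (verts H) \<le> card {w \<in> B\<^sub>1. {x, w} \<notin> F}"
      "\<And>x. x \<in> U - (X\<^sub>1 \<union> X\<^sub>2) \<Longrightarrow> card (verts H) \<le> card {w \<in> B\<^sub>2. {x, w} \<notin> F}"
  shows "\<exists>C. \<forall>n\<ge>card (Z \<union> Y).
    rwsat n H \<le> n div card U * (card F + (card X\<^sub>1 + card X\<^sub>2) * card Z) + C"
proof -
  let ?Q = "card F + (card X\<^sub>1 + card X\<^sub>2) * card Z" and ?s = "card (Z \<union> Y)" and ?m = "card U"
  obtain E c where E: "over_skeleton (Z \<union> Y) E c" by (rule over_skeleton_base)
  have blocks: "\<exists>V' E' c'. over_skeleton V' E' c' \<and> card V' = ?s + k * ?m \<and> card E' \<le> card E + k * ?Q" for k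
  proof (induction k)
    case 0
    show ?case using E by auto
  next
    case (Suc k)
    then obtain V' E' c' where G: "over_skeleton V' E' c'" "card V' = ?s + k * ?m"
      "card E' \<le> card E + k * ?Q" by blast
    obtain V'' E'' c'' where "over_skeleton V'' E'' c''" "card V'' = card V' + ?m"
        "card E'' \<le> card E' + ?Q"
      by (rule over_skeleton_add_disjoint_copy[OF G(1) block(1-3) X B card_B])
    then show ?case using G(2,3) by (intro exI[of _ V''] exI[of _ E''] exI[of _ c'']) auto
  qed
  have d: "min_pos_degree H - 1 \<le> card Z - 1"
  proof -
    have "card Z\<^sub>1 \<le> card Z" using finite_skeleton by (intro card_mono) auto
    then show ?thesis using card_skeleton(1) min_pos_degree_less by linarith
  qed
  have "0 < ?m" using block(3,4) by (simp add: card_gt_0_iff)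
  have "rwsat n H \<le> n div ?m * ?Q + (card E + ?m * card Z)" if n: "?s \<le> n" for n
  proof -
    let ?k = "(n - ?s) div ?m" and ?r = "(n - ?s) mod ?m"
    obtain V' E' c' where G: "over_skeleton V' E' c'" "card V' = ?s + ?k * ?m"
        "card E' \<le> card E + ?k * ?Q"
      using blocks by blast
    obtain V'' E'' c'' where G': "over_skeleton V'' E'' c''" "card V'' = card V' + ?r"
        "card E'' \<le> card E' + ?r * card Z"
      using over_skeleton_add_vertices[OF G(1) d] by blast
    have "?r * card Z \<le> ?m * card Z" using \<open>0 < ?m\<close> by (intro mult_right_mono) auto
    moreover have "?k * ?Q \<le> n div ?m * ?Q" by (intro mult_right_mono div_le_mono) auto
    moreover have "card V'' = n" using G(2) G'(2) n div_mult_mod_eq[of "n - ?s" ?m] by linarith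
    then have "rwsat n H \<le> card E''" using rwsat_le_over_skeleton[OF G'(1)] by simp
    ultimately show ?thesis using G(3) G'(3) by linarith
  qed
  then show ?thesis by blast
qed

text \<open>The block is an optimal graph on \<open>m\<close> vertices. By the linear bound it is
  sparse, so attaching it costs at most \<open>\<epsilon> / 2 * m\<close> further edges; the
  additive constant is at most \<open>\<epsilon> / 2 * n\<close> for large \<open>n\<close>.\<close>

lemma rwsat_eventually_le_add:
  fixes \<epsilon> :: real
  assumes "0 < \<epsilon>"
  shows "\<exists>M. \<forall>m\<ge>M. \<forall>\<^sub>F n in sequentially. rwsat n H / n \<le> rwsat m H / m + \<epsilon>"
proof -
  define h where "h = card Z"
  \<comment> \<open>The cap at 1 is required by \<open>sparse_graph_independent_sets\<close>; the
    other term makes \<open>\<delta> * h\<close> at most \<open>\<epsilon> / 2\<close>.\<close>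
  define \<delta> where "\<delta> = min 1 (\<epsilon> / (2 * (h + 1)))"
  have \<delta>: "0 < \<delta>" "\<delta> \<le> 1" using assms by (auto simp: \<delta>_def)
  have "\<delta> * h \<le> \<epsilon> / (2 * (h + 1)) * h" by (intro mult_right_mono) (auto simp: \<delta>_def)
  also have "\<dots> \<le> \<epsilon> / 2" using assms by (simp add: field_simps)
  finally have \<delta>_h: "\<delta> * h \<le> \<epsilon> / 2" .
  have "card Z\<^sub>1 \<le> card Z" using finite_skeleton by (intro card_mono) auto
  then have "min_pos_degree H - 1 \<le> card Z - 1" using card_skeleton(1) min_pos_degree_less by linarith
  then obtain C\<^sub>0 where C\<^sub>0: "\<And>n. card (Z \<union> Y) \<le> n \<Longrightarrow> rwsat n H \<le> h * n + C\<^sub>0"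
    using rwsat_le_linear[of "card Z"] unfolding h_def by blast
  obtain M where M: "\<And>(U :: nat set) F. finite U \<Longrightarrow> F \<subseteq> [U]\<^bsup>2\<^esup> \<Longrightarrow> M \<le> card U \<Longrightarrow>
    card F \<le> real (h + C\<^sub>0) * card U \<Longrightarrow>
    \<exists>X\<^sub>1 X\<^sub>2 B\<^sub>1 B\<^sub>2. X\<^sub>1 \<subseteq> U \<and> X\<^sub>2 \<subseteq> U \<and> X\<^sub>1 \<inter> X\<^sub>2 = {} \<and> B\<^sub>1 \<subseteq> X\<^sub>1 \<and> B\<^sub>2 \<subseteq> X\<^sub>2 \<and>
      [B\<^sub>1]\<^bsup>2\<^esup> \<inter> F = {} \<and> [B\<^sub>2]\<^bsup>2\<^esup> \<inter> F = {} \<and>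
      (\<forall>x\<in>U - (X\<^sub>1 \<union> X\<^sub>2). card (verts H) \<le> card {w \<in> B\<^sub>1. {x, w} \<notin> F} \<and>
        card (verts H) \<le> card {w \<in> B\<^sub>2. {x, w} \<notin> F}) \<and>
      real (card X\<^sub>1 + card X\<^sub>2) \<le> \<delta> * card U"
    by (rule sparse_graph_independent_sets[OF \<delta>, of "real (h + C\<^sub>0)" "card (verts H)"]) auto
  have "\<forall>\<^sub>F n in sequentially. rwsat n H / n \<le> rwsat m H / m + \<epsilon>"
    if m: "max (max 1 M) (card (Z \<union> Y)) \<le> m" for m
  proof -
    obtain U :: "nat set" and F b where U: "finite U" "card U = m" "F \<subseteq> [U]\<^bsup>2\<^esup>" "card F = rwsat m H"
      "fillable H U F b ([U]\<^bsup>2\<^esup> - F)" by (rule rwsat_attained[of m])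
    have "C\<^sub>0 * 1 \<le> C\<^sub>0 * m" using m by (intro mult_le_mono2) simp
    moreover have "rwsat m H \<le> h * m + C\<^sub>0" using C\<^sub>0[of m] m by simp
    ultimately have "rwsat m H \<le> h * m + C\<^sub>0 * m" by linarith
    then have "rwsat m H \<le> (h + C\<^sub>0) * m" by (simp add: add_mult_distrib)
    then have "real (card F) \<le> real (h + C\<^sub>0) * card U" using U(2,4) by (metis of_nat_le_iff of_nat_mult)
    then obtain X\<^sub>1 X\<^sub>2 B\<^sub>1 B\<^sub>2 where X: "X\<^sub>1 \<subseteq> U" "X\<^sub>2 \<subseteq> U" "X\<^sub>1 \<inter> X\<^sub>2 = {}" "B\<^sub>1 \<subseteq> X\<^sub>1" "B\<^sub>2 \<subseteq> X\<^sub>2"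
      and B: "[B\<^sub>1]\<^bsup>2\<^esup> \<inter> F = {}" "[B\<^sub>2]\<^bsup>2\<^esup> \<inter> F = {}"
      and card_B: "\<And>x. x \<in> U - (X\<^sub>1 \<union> X\<^sub>2) \<Longrightarrow> card (verts H) \<le> card {w \<in> B\<^sub>1. {x, w} \<notin> F}"
        "\<And>x. x \<in> U - (X\<^sub>1 \<union> X\<^sub>2) \<Longrightarrow> card (verts H) \<le> card {w \<in> B\<^sub>2. {x, w} \<notin> F}"
      and few: "real (card X\<^sub>1 + card X\<^sub>2) \<le> \<delta> * card U"
      using M[OF U(1,3)] m U(2) by fastforce
    have "0 < m" using m by simp
    then have "U \<noteq> {}" using U(2) by auto
    define Q where "Q = card F + (card X\<^sub>1 + card X\<^sub>2) * card Z"
    obtain C where C: "\<And>n. card (Z \<union> Y) \<le> n \<Longrightarrow> rwsat n H \<le> n div m * Q + C"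
      using rwsat_le_blocks[OF U(5,3,1) \<open>U \<noteq> {}\<close> X B card_B] U(2) unfolding Q_def by metis
    have "real Q = rwsat m H + real (card X\<^sub>1 + card X\<^sub>2) * h" using U(4) by (simp add: Q_def h_def)
    also have "\<dots> \<le> rwsat m H + \<delta> * m * h"
      using few U(2) by (intro add_left_mono mult_right_mono) auto
    also have "\<dots> \<le> rwsat m H + \<epsilon> / 2 * m"
      using mult_right_mono[OF \<delta>_h, of m] by (simp add: algebra_simps)
    finally have "Q / m \<le> (rwsat m H + \<epsilon> / 2 * m) / m" by (intro divide_right_mono) auto
    also have "\<dots> = rwsat m H / m + \<epsilon> / 2" using \<open>0 < m\<close> by (simp add: add_divide_distrib)
    finally have Q: "Q / m \<le> rwsat m H / m + \<epsilon> / 2" .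
    have "rwsat n H / n \<le> rwsat m H / m + \<epsilon>"
      if n: "max (max 1 (card (Z \<union> Y))) (nat \<lceil>2 * C / \<epsilon>\<rceil>) \<le> n" for n
    proof -
      have "0 < n" using n by simp
      have "real (rwsat n H) \<le> real (n div m * Q + C)" using C[of n] n by (intro of_nat_mono) simp
      also have "\<dots> = real (n div m) * Q + C" by simp
      also have "\<dots> \<le> n / m * Q + C" by (intro add_right_mono mult_right_mono of_nat_div_le_of_nat) auto
      finally have "rwsat n H / n \<le> (n / m * Q + C) / n" by (intro divide_right_mono) auto
      also have "\<dots> = Q / m + C / n" using \<open>0 < n\<close> by (simp add: field_simps)
      finally have "rwsat n H / n \<le> Q / m + C / n" .
      moreover have "2 * C / \<epsilon> \<le> n" using n by linarith
      then have "C / n \<le> \<epsilon> / 2" using assms \<open>0 < n\<close> by (simp add: field_simps)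
      ultimately show ?thesis using Q by linarith
    qed
    then show ?thesis unfolding eventually_sequentially by blast
  qed
  then show ?thesis by blast
qed

end

section \<open>The limit and its bounds\<close>

context nonempty_graph
begin

lemma skeleton_exists: "\<exists>Z\<^sub>1 Z\<^sub>2 Y. skeleton H Z\<^sub>1 Z\<^sub>2 Y"
proof -
  let ?h = "card (verts H)"
  have "skeleton H {..<?h} {?h..<2 * ?h} {2 * ?h..<3 * ?h}"
    by unfold_locales auto
  then show ?thesis by blast
qed

lemma convergent_rwsat: "convergent (\<lambda>n. rwsat n H / n)"
proof -
  obtain Z\<^sub>1 Z\<^sub>2 Y where "skeleton H Z\<^sub>1 Z\<^sub>2 Y" using skeleton_exists by blast
  then show ?thesis
    by (intro convergent_if_eventually_le_add skeleton.rwsat_eventually_le_add) auto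
qed

lemma limit_rwsat_le:
  assumes "(\<lambda>n. rwsat n H / n) \<longlonglongrightarrow> L" "min_pos_degree H - 1 \<le> d - 1" "d < card (verts H)"
  shows "L \<le> real d"
proof -
  obtain Z\<^sub>1 Z\<^sub>2 Y where sk: "skeleton H Z\<^sub>1 Z\<^sub>2 Y" using skeleton_exists by blast
  have "card Z\<^sub>1 \<le> card (Z\<^sub>1 \<union> Z\<^sub>2)" using skeleton.finite_skeleton[OF sk] by (intro card_mono) auto
  then have "d \<le> card (Z\<^sub>1 \<union> Z\<^sub>2)" using skeleton.card_skeleton(1)[OF sk] assms(3) by linarith
  then obtain C where C: "\<And>n. card (Z\<^sub>1 \<union> Z\<^sub>2 \<union> Y) \<le> n \<Longrightarrow> rwsat n H \<le> d * n + C"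
    using skeleton.rwsat_le_linear[OF sk assms(2)] by blast
  have "rwsat n H / n \<le> d + C / n" if n: "max 1 (card (Z\<^sub>1 \<union> Z\<^sub>2 \<union> Y)) \<le> n" for n
  proof -
    have "real (rwsat n H) \<le> real (d * n + C)" using C[of n] n by (intro of_nat_mono) simp
    then show ?thesis using n by (simp add: field_simps)
  qed
  moreover have "(\<lambda>n. d + C / n) \<longlonglongrightarrow> real d + 0"
    by (intro tendsto_add tendsto_const lim_const_over_n)
  ultimately show ?thesis
    using LIMSEQ_le[OF assms(1)] by (metis add.right_neutral)
qed

lemma limit_rwsat_ge:
  assumes "(\<lambda>n. rwsat n H / n) \<longlonglongrightarrow> L" "2 \<le> min_pos_degree H"
  shows "min_pos_degree H / 2 \<le> L"
proof (rule LIMSEQ_le_const[OF assms(1)])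
  have "min_pos_degree H / 2 \<le> rwsat n H / n" if n: "Suc (min_pos_degree H) \<le> n" for n
  proof -
    have "real (min_pos_degree H * n) \<le> real (2 * rwsat n H)"
      using rwsat_lower_bound[OF assms(2), of n] n by (intro of_nat_mono) simp
    then show ?thesis using n by (simp add: field_simps)
  qed
  then show "\<exists>N. \<forall>n\<ge>N. min_pos_degree H / 2 \<le> rwsat n H / n" by blast
qed

lemma pendant_edge_imp_min_pos_degree:
  assumes "pendant_edge H e"
  shows "min_pos_degree H \<le> 1"
proof -
  obtain v where "v \<in> e" "e \<in> edges H" "degree H v = 1" using assms by (auto simp: pendant_edge_def)
  moreover have "v \<in> verts H" using \<open>v \<in> e\<close> \<open>e \<in> edges H\<close> edges_subset by (auto simp: nsets_def)
  ultimately show ?thesis using min_pos_degree_le[of v] by simp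
qed

lemma no_pendant_edge_imp_min_pos_degree:
  assumes "\<nexists>e. pendant_edge H e"
  shows "2 \<le> min_pos_degree H"
proof -
  obtain u where u: "degree H u = min_pos_degree H" "degree H u \<noteq> 0" by (rule min_pos_degree_attained)
  then have "{e \<in> edges H. u \<in> e} \<noteq> {}" unfolding degree_def by (metis card.empty)
  then obtain e where "e \<in> edges H" "u \<in> e" by blast
  then have "degree H u \<noteq> 1" using assms by (auto simp: pendant_edge_def)
  then show ?thesis using u by simp
qed

end

theorem theorem1p3:
  fixes H :: "'a sgraph"
  assumes "finite_simple_graph H" and "edges H \<noteq> {}"
  shows "((\<exists>e. pendant_edge H e) \<longrightarrow>
            (\<lambda>n. real (rwsat n H) / real n) \<longlonglongrightarrow> 0) \<and>
         ((\<nexists>e. pendant_edge H e) \<longrightarrow>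
            (\<exists>L. (\<lambda>n. real (rwsat n H) / real n) \<longlonglongrightarrow> L \<and>
                 1 / 2 * real (min_pos_degree H) \<le> L \<and> L \<le> real (min_pos_degree H)))"
proof -
  interpret nonempty_graph H using assms by unfold_locales
  obtain L where L: "(\<lambda>n. real (rwsat n H) / real n) \<longlonglongrightarrow> L"
    using convergent_rwsat by (auto simp: convergent_def)
  have "L = 0" if "pendant_edge H e" for e
  proof (rule antisym)
    show "L \<le> 0"
      \<comment> \<open>A pendant edge makes \<open>min_pos_degree H - 1\<close> zero, so new
        vertices can be attached with no old edges at all.\<close>
      using limit_rwsat_le[OF L, of 0] pendant_edge_imp_min_pos_degree[OF that] min_pos_degree_less by simp
    show "0 \<le> L" using L by (rule LIMSEQ_le_const) auto
  qed
  moreover have "1 / 2 * real (min_pos_degree H) \<le> L \<and> L \<le> real (min_pos_degree H)"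
    if "\<nexists>e. pendant_edge H e"
    using limit_rwsat_ge[OF L no_pendant_edge_imp_min_pos_degree[OF that]]
      limit_rwsat_le[OF L order_refl min_pos_degree_less] by simp
  ultimately show ?thesis using L by blast
qed

end
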